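(* Let $\{\varphi_r\}_{0<r<1}$ be an arbitrary approximate identity on $\mathbb{T}$, let $1<p<\infty$, and let $\lambda:(0,1)\to(0,\infty)$ be a function with $\lim_{r\to1}\lambda(r)=0$ satisfying $$\Pi_p(\lambda,\varphi):=\limsup_{r\to1}\lambda(r)\,\|\varphi_r\|_\infty\,\varphi_*(r)^{p-1}<\infty .$$ Then for every $f\in L^p(\mathbb{T})$, $$\lim_{\substack{r\to1\\ y\in\lambda(r,x)}}\Phi_r(y,f)=f(x)\quad\text{for almost every }x\in\mathbb{T}.$$
   Context: $\mathbb{T}=\mathbb{R}/2\pi\mathbb{Z}$ is the unit circle, with points represented by $[-\pi,\pi]$ (endpoints identified), Lebesgue measure $dt$, and $\|\cdot\|_q$ the norm of $L^q(\mathbb{T})$. An approximate identity is a family $\{\varphi_r\}_{0<r<1}\subset L^\infty(\mathbb{T})$ such that: ($\Phi1$) $\int_{\mathbb{T}}\varphi_r(t)\,dt\to1$ as $r\to1$; ($\Phi2$) $\varphi_r^*(x):=\sup_{|x|\le|t|\le\pi}|\varphi_r(t)|\to0$ as $r\to1$ for every $0<|x|\le\pi$; ($\Phi3$) $C_\varphi:=\sup_{0<r<1}\|\varphi_r^*\|_1<\infty$. Put $\varphi_*(r)=\sup_{x\in\mathbb{T}}|x\,\varphi_r^*(x)|$ and $\Phi_r(x,f)=\int_{\mathbb{T}}\varphi_r(x-t)f(t)\,dt$. $\lambda(r,x)$ denotes the interval $[x-\lambda(r),x+\lambda(r)]$ in $\mathbb{T}$, with $\lambda(r,x)=\mathbb{T}$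 if $\lambda(r)\ge\pi$. The notation $\lim_{r\to1,\ y\in\lambda(r,x)}F_r(y)=A$ means $\lim_{r\to1}\sup_{y\in\lambda(r,x)}|F_r(y)-A|=0$. *)

theory Defs
  imports "HOL-Analysis.Analysis" "HOL-Probability.Essential_Supremum"
    "HOL-Library.Periodic_Fun"
begin

text \<open>Functions on the circle are \<open>2\<pi>\<close>-periodic functions on \<^typ>\<open>real\<close>, integrated over
  \<open>[-\<pi>, \<pi>]\<close>; counting both endpoints is harmless since they form a null set. All functions are
  complex-valued, which includes the real-valued ones. The limit \<open>r \<rightarrow> 1\<close> over \<open>0 < r < 1\<close>
  is the filter \<open>at_left 1\<close>.\<close>

definition circle :: "real measure" where
  "circle = lebesgue_on {-pi..pi}"

definition Lp_circle :: "real \<Rightarrow> (real \<Rightarrow> complex) set" where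
  "Lp_circle p = {f. periodic_fun_simple f (2 * pi) \<and> f \<in> borel_measurable circle \<and>
     (\<integral>\<^sup>+ t. ennreal (norm (f t) powr p) \<partial>circle) < \<infinity>}"

definition Linf_norm :: "(real \<Rightarrow> complex) \<Rightarrow> ennreal" where
  "Linf_norm g = esssup circle (\<lambda>t. ennreal (norm (g t)))"

definition Linf_circle :: "(real \<Rightarrow> complex) set" where
  "Linf_circle = {g. periodic_fun_simple g (2 * pi) \<and> g \<in> borel_measurable circle \<and>
     Linf_norm g < \<infinity>}"

text \<open>The majorant \<open>\<phi>\<^sub>r\<^sup>*(x)\<close> for \<open>\<phi>\<^sub>r = g\<close> and \<open>\<bar>x\<bar> \<le> \<pi>\<close>. The supremum is the essential one, since
  elements of \<open>L\<^sup>\<infinity>\<close> are determined only almost everywhere. It is bounded by the pointwise supremum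
  of any representative, so the conditions below are implied by their pointwise versions.\<close>

definition majorant :: "(real \<Rightarrow> complex) \<Rightarrow> real \<Rightarrow> ennreal" where
  "majorant g x = esssup (lebesgue_on {t. \<bar>x\<bar> \<le> \<bar>t\<bar> \<and> \<bar>t\<bar> \<le> pi}) (\<lambda>t. ennreal (norm (g t)))"

definition approximate_identity :: "(real \<Rightarrow> real \<Rightarrow> complex) \<Rightarrow> bool" where
  "approximate_identity \<phi> \<longleftrightarrow>
     (\<forall>r\<in>{0<..<1}. \<phi> r \<in> Linf_circle) \<and>
     ((\<lambda>r. LINT t|circle. \<phi> r t) \<longlongrightarrow> 1) (at_left 1) \<and>
     (\<forall>x. 0 < \<bar>x\<bar> \<and> \<bar>x\<bar> \<le> pi \<longrightarrow> ((\<lambda>r. majorant (\<phi> r) x) \<longlongrightarrow> 0) (at_left 1)) \<and>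
     (SUP r\<in>{0<..<1}. \<integral>\<^sup>+ x. majorant (\<phi> r) x \<partial>circle) < \<infinity>"

text \<open>The quantity \<open>\<phi>\<^sub>*(r)\<close> for \<open>\<phi>\<^sub>r = g\<close>.\<close>

definition phi_star :: "(real \<Rightarrow> complex) \<Rightarrow> ennreal" where
  "phi_star g = (SUP x\<in>{-pi..pi}. ennreal \<bar>x\<bar> * majorant g x)"

text \<open>The conversions \<open>enn2real\<close> lose nothing for \<open>\<phi>\<^sub>r\<close> in \<open>L\<^sup>\<infinity>\<close>: there
  \<open>Linf_norm\<close> is finite and \<open>phi_star\<close> is at most \<open>\<pi>\<close> times \<open>Linf_norm\<close>.\<close>

definition Pi_p :: "real \<Rightarrow> (real \<Rightarrow> real) \<Rightarrow> (real \<Rightarrow> real \<Rightarrow> complex) \<Rightarrow> ennreal" where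
  "Pi_p p lam \<phi> = Limsup (at_left 1)
     (\<lambda>r. ennreal (lam r * enn2real (Linf_norm (\<phi> r)) * enn2real (phi_star (\<phi> r)) powr (p - 1)))"

definition Phi :: "(real \<Rightarrow> real \<Rightarrow> complex) \<Rightarrow> real \<Rightarrow> real \<Rightarrow> (real \<Rightarrow> complex) \<Rightarrow> complex" where
  "Phi \<phi> r x f = (LINT t|circle. \<phi> r (x - t) * f t)"

text \<open>The arc \<open>\<lambda>(r,x)\<close> as a set of real representatives of its points.\<close>

definition arc_around :: "(real \<Rightarrow> real) \<Rightarrow> real \<Rightarrow> real \<Rightarrow> real set" where
  "arc_around lam r x = (if lam r \<ge> pi then UNIV else {x - lam r..x + lam r})"

definition lambda_limit ::
  "(real \<Rightarrow> real) \<Rightarrow> real \<Rightarrow> (real \<Rightarrow> real \<Rightarrow> complex) \<Rightarrow> complex \<Rightarrow> bool" where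
  "lambda_limit lam x F A \<longleftrightarrow>
     ((\<lambda>r. SUP y\<in>arc_around lam r x. ennreal (norm (F r y - A))) \<longlongrightarrow> 0) (at_left 1)"

end

theory Submission
  imports Defs
begin

text \<open>The limit exists at every \<open>L\<^sup>p\<close> Lebesgue point \<open>x\<close> of \<open>f\<close>, that is, wherever the mean of
  \<open>\<bar>f - f x\<bar>\<^sup>p\<close> over \<open>[x - h, x + h]\<close> tends to \<open>0\<close> with \<open>h\<close>. Almost every point is one
  (\<open>AE_Lp_lebesgue_point\<close>).

  Put \<open>G v = \<bar>f (x + v) - f x\<bar>\<close> and let \<open>y = x + s\<close> with \<open>\<bar>s\<bar> \<le> \<lambda> = \<lambda>(r)\<close>. Since \<open>\<integral>\<phi>\<^sub>r \<rightarrow> 1\<close>, the task is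
  to make \<open>\<integral> \<bar>\<phi>\<^sub>r u\<bar> G (s - u) du\<close> small, uniformly in \<open>s\<close>. The integral splits into three parts.

  For \<open>\<bar>u\<bar> \<le> 2 \<lambda>\<close> the kernel is below \<open>min \<parallel>\<phi>\<^sub>r\<parallel> (\<phi>\<^sub>*(r) / \<bar>u\<bar>)\<close>. The conjugate exponent norm of this
  function has \<open>p\<close>-th power comparable to \<open>\<parallel>\<phi>\<^sub>r\<parallel> \<phi>\<^sub>*(r)\<^bsup>p - 1\<^esup>\<close>, while the integral of \<open>G\<^sup>p\<close> over
  \<open>[-3 \<lambda>, 3 \<lambda>]\<close> is \<open>o(\<lambda>)\<close>. By Hoelder's inequality this part is \<open>o(1)\<close> because
  \<open>\<lambda> \<parallel>\<phi>\<^sub>r\<parallel> \<phi>\<^sub>*(r)\<^bsup>p - 1\<^esup>\<close> stays bounded. This is the only place where the hypothesis on \<open>\<Pi>\<^sub>p\<close> enters;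
  the inequality is proved in an elementary form with a free parameter \<open>\<eta>\<close> (\<open>kernel_near_bound\<close>).

  For \<open>2 \<lambda> \<le> \<bar>u\<bar> \<le> D\<close> the shift by \<open>s\<close> is harmless, and the classical argument for kernels with an
  integrable radially decreasing majorant applies: the part is at most a small multiple of
  \<open>\<integral>\<phi>\<^sub>r\<^sup>*\<close> (\<open>kernel_far_bound\<close>).

  For \<open>\<bar>u\<bar> > D\<close> the kernel is at most \<open>\<phi>\<^sub>r\<^sup>*(D)\<close>, which tends to \<open>0\<close>, and \<open>G\<close> is integrable over a
  period.

  The three parts are added up in \<open>kernel_deviation_bound\<close>, and
  \<open>lambda_limit_at_Lp_lebesgue_point\<close> chooses the parameters.\<close>

section \<open>Affine substitutions for Lebesgue measure\<close>

lemma lebesgue_borel_ident [measurable]: "(\<lambda>x::real. x) \<in> borel_measurable lebesgue"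
  using id_borel_measurable_lebesgue by (simp add: id_def)

lemma measurable_lebesgue_affine:
  fixes c :: real
  assumes "c \<noteq> 0"
  shows "(\<lambda>x. t + c * x) \<in> lebesgue \<rightarrow>\<^sub>M lebesgue"
  using lebesgue_affine_measurable[where c = "\<lambda>x::real. c" and t = t] assms by simp

lemma borel_measurable_lebesgue_translate:
  fixes x :: real
  assumes "f \<in> borel_measurable lebesgue"
  shows "(\<lambda>v. f (x + v)) \<in> borel_measurable lebesgue"
  using measurable_compose[OF measurable_lebesgue_affine[of 1 x] assms] by simp

lemma borel_measurable_lebesgue_reflect:
  fixes x :: real
  assumes "f \<in> borel_measurable lebesgue"
  shows "(\<lambda>v. f (x - v)) \<in> borel_measurable lebesgue"
  using measurable_compose[OF measurable_lebesgue_affine[of "-1" x] assms] by simp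

lemma nn_integral_lebesgue_translate:
  fixes x :: real
  assumes "f \<in> borel_measurable lebesgue"
  shows "(\<integral>\<^sup>+v. f (x + v) \<partial>lebesgue) = (\<integral>\<^sup>+v. f v \<partial>lebesgue)"
  using nn_integral_real_affine_lebesgue[OF assms, of 1 x] by simp

lemma nn_integral_lebesgue_reflect:
  fixes x :: real
  assumes "f \<in> borel_measurable lebesgue"
  shows "(\<integral>\<^sup>+v. f (x - v) \<partial>lebesgue) = (\<integral>\<^sup>+v. f v \<partial>lebesgue)"
  using nn_integral_real_affine_lebesgue[OF assms, of "-1" x] by simp

lemma AE_lebesgue_uminus:
  fixes P :: "real \<Rightarrow> bool"
  assumes "AE x in lebesgue. P x"
  shows "AE x in lebesgue. P (- x)"
proof -
  obtain N where N: "N \<in> null_sets lebesgue" "{x. \<not> P x} \<subseteq> N"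
    using assms by (auto simp: eventually_ae_filter)
  have "negligible (uminus ` N)"
    using N(1)
    by (intro negligible_differentiable_image_negligible[OF order_refl])
      (simp_all add: negligible_iff_null_sets differentiable_on_def)
  moreover have "{x. \<not> P (- x)} \<subseteq> uminus ` N"
    using N(2) by (auto intro!: image_eqI[of _ uminus "- x" for x])
  ultimately show ?thesis
    by (intro AE_I'[of "uminus ` N"]) (simp_all add: negligible_iff_null_sets)
qed

section \<open>Lebesgue points\<close>

text \<open>Lebesgue's differentiation theorem for the averages over \<open>[x, x + h]\<close>, reduced to an upper
  estimate of a nonnegative integral moved to the origin, the form in which it is summed below.\<close>
lemma AE_right_average:
  fixes F :: "real \<Rightarrow> real"
  assumes F: "integrable lebesgue F" and nn: "\<And>t. 0 \<le> F t"
  shows "AE x in lebesgue. \<forall>e>0. \<exists>d>0. \<forall>h\<in>{0<..d}.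
    (\<integral>\<^sup>+v\<in>{0..h}. ennreal (F (x + v)) \<partial>lebesgue) \<le> ennreal (h * (F x + e))"
proof -
  have int: "set_integrable lebesgue {a..b} F" for a b
    unfolding set_integrable_def using F by (intro integrable_mult_indicator) auto
  then have "F integrable_on cbox a b" for a b
    using set_lebesgue_integral_eq_integral(1)[OF int] by simp
  then obtain N where N: "negligible N"
    and avg: "\<And>x e. x \<notin> N \<Longrightarrow> 0 < e \<Longrightarrow> \<exists>d>0. \<forall>h. 0 < h \<and> h < d \<longrightarrow>
      norm (integral (cbox x (x + h *\<^sub>R One)) F /\<^sub>R h ^ DIM(real) - F x) < e"
    using integrable_ccontinuous_explicit[of F] by blast
  have eq: "(\<integral>\<^sup>+v\<in>{0..h}. ennreal (F (x + v)) \<partial>lebesgue) = ennreal (integral {x..x + h} F)" for x h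
  proof -
    have [measurable]: "F \<in> borel_measurable lebesgue" using F by auto
    have "ennreal (integral {x..x+h} F) = ennreal (LINT t|lebesgue. indicator {x..x+h} t *\<^sub>R F t)"
      using set_lebesgue_integral_eq_integral(2)[OF int, of x "x+h"]
      by (simp add: set_lebesgue_integral_def)
    also have "\<dots> = (\<integral>\<^sup>+t. ennreal (indicator {x..x+h} t *\<^sub>R F t) \<partial>lebesgue)"
      using int[of x "x+h"] nn unfolding set_integrable_def
      by (intro nn_integral_eq_integral[symmetric]) auto
    also have "\<dots> = (\<integral>\<^sup>+t. ennreal (indicator {x..x+h} (x + t) *\<^sub>R F (x + t)) \<partial>lebesgue)"
      by (rule nn_integral_lebesgue_translate[symmetric]) measurable
    also have "\<dots> = (\<integral>\<^sup>+v\<in>{0..h}. ennreal (F (x + v)) \<partial>lebesgue)"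
      by (intro nn_integral_cong) (auto simp: indicator_def)
    finally show ?thesis by simp
  qed
  have "\<exists>d>0. \<forall>h\<in>{0<..d}.
    (\<integral>\<^sup>+v\<in>{0..h}. ennreal (F (x + v)) \<partial>lebesgue) \<le> ennreal (h * (F x + e))"
    if xe: "x \<notin> N" "0 < e" for x e
  proof -
    obtain d where d: "d > 0" and *: "\<And>h. 0 < h \<Longrightarrow> h < d \<Longrightarrow> \<bar>integral {x..x+h} F / h - F x\<bar> < e"
      using avg[OF xe] by (auto simp: divide_inverse_commute)
    have "integral {x..x+h} F \<le> h * (F x + e)" if "0 < h" "h < d" for h
      using *[OF that] that by (auto simp: abs_less_iff field_simps)
    then show ?thesis using d unfolding eq
      by (intro exI[of _ "d/2"]) (auto intro!: ennreal_leI)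
  qed
  then have "{x. \<not> (\<forall>e>0. \<exists>d>0. \<forall>h\<in>{0<..d}.
      (\<integral>\<^sup>+v\<in>{0..h}. ennreal (F (x + v)) \<partial>lebesgue) \<le> ennreal (h * (F x + e)))} \<subseteq> N"
    by blast
  then show ?thesis
    using N by (intro AE_I'[of N]) (auto simp: negligible_iff_null_sets)
qed

text \<open>The left half of the interval is the right half for \<open>t \<mapsto> F (- t)\<close>, so the one-sided estimate,
  applied to \<open>F\<close> and to its reflection, gives the two-sided one.\<close>
lemma AE_symmetric_average:
  fixes F :: "real \<Rightarrow> real"
  assumes F: "integrable lebesgue F" and nn: "\<And>t. 0 \<le> F t"
  shows "AE x in lebesgue. \<forall>e>0. \<exists>d>0. \<forall>h\<in>{0<..d}.
    (\<integral>\<^sup>+v\<in>{-h..h}. ennreal (F (x + v)) \<partial>lebesgue) \<le> ennreal (2 * h * (F x + e))"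
proof -
  have [measurable]: "F \<in> borel_measurable lebesgue" using F by auto
  have F': "integrable lebesgue (\<lambda>t. F (- t))"
    using lebesgue_integrable_real_affine_iff[of "-1" F 0] F by simp
  let ?P = "\<lambda>F x. \<forall>e>0. \<exists>d>0. \<forall>h\<in>{0<..d}.
    (\<integral>\<^sup>+v\<in>{0..h}. ennreal (F (x + v)) \<partial>lebesgue) \<le> ennreal (h * (F x + e))"
  have "AE x in lebesgue. ?P (\<lambda>t. F (- t)) (- x)"
    using AE_right_average[OF F'] nn by (intro AE_lebesgue_uminus) simp
  with AE_right_average[OF assms] show ?thesis
  proof eventually_elim
    case (elim x)
    show ?case
    proof (intro allI impI)
      fix e :: real assume e: "e > 0"
      obtain d1 where d1: "d1 > 0" "\<And>h. h \<in> {0<..d1} \<Longrightarrow>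
        (\<integral>\<^sup>+v\<in>{0..h}. ennreal (F (x + v)) \<partial>lebesgue) \<le> ennreal (h * (F x + e))"
        using elim(1) e by blast
      obtain d2 where d2: "d2 > 0" "\<And>h. h \<in> {0<..d2} \<Longrightarrow>
        (\<integral>\<^sup>+v\<in>{0..h}. ennreal (F (- (- x + v))) \<partial>lebesgue) \<le> ennreal (h * (F (- (- x)) + e))"
        using elim(2) e by blast
      show "\<exists>d>0. \<forall>h\<in>{0<..d}.
        (\<integral>\<^sup>+v\<in>{-h..h}. ennreal (F (x + v)) \<partial>lebesgue) \<le> ennreal (2 * h * (F x + e))"
      proof (intro exI[of _ "min d1 d2"] conjI ballI)
        fix h assume h: "h \<in> {0<..min d1 d2}"
        have [measurable]: "(\<lambda>v. F (x + v)) \<in> borel_measurable lebesgue"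
          by (rule borel_measurable_lebesgue_translate) measurable
        have "(\<integral>\<^sup>+v\<in>{-h..h}. ennreal (F (x + v)) \<partial>lebesgue)
          \<le> (\<integral>\<^sup>+v. ennreal (F (x + v)) * indicator {0..h} v + ennreal (F (x + v)) * indicator {-h..0} v \<partial>lebesgue)"
          by (intro nn_integral_mono) (auto simp: indicator_def)
        also have "\<dots> = (\<integral>\<^sup>+v\<in>{0..h}. ennreal (F (x + v)) \<partial>lebesgue)
          + (\<integral>\<^sup>+v\<in>{-h..0}. ennreal (F (x + v)) \<partial>lebesgue)"
          by (intro nn_integral_add) auto
        also have "(\<integral>\<^sup>+v\<in>{-h..0}. ennreal (F (x + v)) \<partial>lebesgue)
          = (\<integral>\<^sup>+v\<in>{0..h}. ennreal (F (- (- x + v))) \<partial>lebesgue)"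
          by (subst nn_integral_lebesgue_reflect[where x = 0, symmetric])
            (auto intro!: nn_integral_cong simp: indicator_def)
        also have "(\<integral>\<^sup>+v\<in>{0..h}. ennreal (F (x + v)) \<partial>lebesgue) + \<dots>
          \<le> ennreal (h * (F x + e)) + ennreal (h * (F x + e))"
          using d1(2)[of h] d2(2)[of h] h by (intro add_mono) auto
        also have "\<dots> = ennreal (2 * h * (F x + e))"
          using h e nn[of x] by (subst ennreal_plus[symmetric]) (auto simp: algebra_simps)
        finally show "(\<integral>\<^sup>+v\<in>{-h..h}. ennreal (F (x + v)) \<partial>lebesgue) \<le> ennreal (2 * h * (F x + e))" .
      qed (use d1 d2 in auto)
    qed
  qed
qed

text \<open>The condition that the mean of \<open>\<bar>f - f x\<bar>\<^sup>p\<close> over \<open>[x - h, x + h]\<close> tends to \<open>0\<close>. It is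
  written with \<open>\<integral>\<^sup>+\<close> and without a quotient, so that no integrability has to be
  carried along.\<close>
definition Lp_lebesgue_point :: "real \<Rightarrow> (real \<Rightarrow> complex) \<Rightarrow> real \<Rightarrow> bool" where
  "Lp_lebesgue_point p f x \<longleftrightarrow> (\<forall>\<epsilon>>0. \<exists>\<delta>>0. \<forall>h\<in>{0<..\<delta>}.
     (\<integral>\<^sup>+v\<in>{-h..h}. ennreal (norm (f (x + v) - f x) powr p) \<partial>lebesgue) \<le> ennreal (\<epsilon> * h))"

lemma powr_add_le:
  fixes a b p :: real
  assumes "0 \<le> a" "0 \<le> b" "0 \<le> p"
  shows "(a + b) powr p \<le> 2 powr p * (a powr p + b powr p)"
proof -
  have "(a + b) powr p \<le> (2 * max a b) powr p"
    using assms by (intro powr_mono2) auto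
  also have "\<dots> = 2 powr p * max a b powr p"
    using assms by (simp add: powr_mult)
  also have "max a b powr p \<le> a powr p + b powr p"
    by (auto simp: max_def)
  finally show ?thesis by simp
qed

text \<open>The averages of \<open>\<bar>f - q\<bar>\<^sup>p\<close> converge almost everywhere for each fixed constant \<open>q\<close>, hence almost
  everywhere for all \<open>q\<close> of a countable dense set at once. At such a point \<open>x\<close>, take \<open>q\<close> close to
  \<open>f x\<close>: then \<open>\<bar>f - f x\<bar>\<^sup>p\<close> exceeds \<open>2\<^sup>p \<bar>f - q\<bar>\<^sup>p\<close> by a small constant at most, and the mean of
  \<open>\<bar>f - q\<bar>\<^sup>p\<close> is close to the small number \<open>\<bar>f x - q\<bar>\<^sup>p\<close>.\<close>
lemma AE_Lp_lebesgue_point: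
  assumes f: "f \<in> Lp_circle p" and p: "0 < p"
  shows "AE x in circle. Lp_lebesgue_point p f x"
proof -
  have fm: "f \<in> borel_measurable (lebesgue_on {-pi..pi})"
    and fin: "(\<integral>\<^sup>+t. ennreal (norm (f t) powr p) \<partial>lebesgue_on {-pi..pi}) < \<infinity>"
    using f by (auto simp: Lp_circle_def circle_def)
  define F where "F q t = indicator {-pi..pi} t * norm (f t - q) powr p" for q :: complex and t
  have F_int: "integrable lebesgue (F q)" for q
  proof -
    have "(\<integral>\<^sup>+t. ennreal (norm (norm (f t - q) powr p)) \<partial>lebesgue_on {-pi..pi})
      \<le> (\<integral>\<^sup>+t. ennreal (2 powr p) * ennreal (norm (f t) powr p)
            + ennreal (2 powr p * norm q powr p) \<partial>lebesgue_on {-pi..pi})"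
    proof (intro nn_integral_mono)
      fix t
      have "norm (f t - q) powr p \<le> (norm (f t) + norm q) powr p"
        using p by (intro powr_mono2 norm_triangle_ineq4) auto
      also have "\<dots> \<le> 2 powr p * (norm (f t) powr p + norm q powr p)"
        using p by (intro powr_add_le) auto
      finally show "ennreal (norm (norm (f t - q) powr p))
          \<le> ennreal (2 powr p) * ennreal (norm (f t) powr p) + ennreal (2 powr p * norm q powr p)"
        by (simp add: ennreal_mult[symmetric] ennreal_plus[symmetric] distrib_left del: ennreal_plus)
    qed
    also have "\<dots> = ennreal (2 powr p) * (\<integral>\<^sup>+t. ennreal (norm (f t) powr p) \<partial>lebesgue_on {-pi..pi})
            + ennreal (2 powr p * norm q powr p) * emeasure (lebesgue_on {-pi..pi}) {-pi..pi}"
      using fm by (simp add: nn_integral_add nn_integral_cmult)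
    also have "\<dots> < \<infinity>"
      using fin by (auto simp: emeasure_restrict_space ennreal_mult_less_top)
    finally have "integrable (lebesgue_on {-pi..pi}) (\<lambda>t. norm (f t - q) powr p)"
      using fm by (intro integrableI_bounded) auto
    then show ?thesis
      unfolding F_def by (subst (asm) integrable_restrict_space) auto
  qed
  have F_nn: "0 \<le> F q t" for q t by (auto simp: F_def)
  obtain D :: "complex set" where D: "countable D" "\<And>X. open X \<Longrightarrow> X \<noteq> {} \<Longrightarrow> \<exists>d\<in>D. d \<in> X"
    by (erule countable_dense_setE)
  have "AE x in lebesgue. \<forall>q\<in>D. \<forall>e>0. \<exists>d>0. \<forall>h\<in>{0<..d}.
      (\<integral>\<^sup>+v\<in>{-h..h}. ennreal (F q (x + v)) \<partial>lebesgue) \<le> ennreal (2 * h * (F q x + e))"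
    using AE_symmetric_average[OF F_int F_nn] D(1) by (subst AE_ball_countable) auto
  moreover have "AE x in lebesgue. x \<notin> {-pi, pi}"
    by (intro AE_not_in) (auto simp: negligible_iff_null_sets[symmetric])
  ultimately have "AE x in lebesgue. x \<in> {-pi..pi} \<longrightarrow> Lp_lebesgue_point p f x"
  proof eventually_elim
    case (elim x)
    show ?case
    proof
      assume "x \<in> {-pi..pi}"
      then have x: "-pi < x" "x < pi" using elim(2) by auto
      show "Lp_lebesgue_point p f x"
        unfolding Lp_lebesgue_point_def
      proof (intro allI impI)
        fix \<epsilon> :: real assume \<epsilon>: "0 < \<epsilon>"
        \<comment> \<open>Three error terms of size \<open>c\<close>, each over an interval of length \<open>2 h\<close> and with the factor
          \<open>2\<^sup>p\<close>, must add up to \<open>\<epsilon> h\<close>.\<close>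
        define c where "c = \<epsilon> / (6 * 2 powr p)"
        have c: "c > 0" using \<epsilon> by (auto simp: c_def)
        obtain q where q: "q \<in> D" "norm (f x - q) < c powr (1 / p)"
          using D(2)[of "ball (f x) (c powr (1/p))"] c by (auto simp: dist_norm)
        have q': "norm (f x - q) powr p \<le> c"
        proof -
          have "norm (f x - q) powr p \<le> (c powr (1 / p)) powr p"
            using q p by (intro powr_mono2) auto
          then show ?thesis using c p by (simp add: powr_powr)
        qed
        obtain d where d: "d > 0" "\<And>h. h \<in> {0<..d} \<Longrightarrow>
            (\<integral>\<^sup>+v\<in>{-h..h}. ennreal (F q (x + v)) \<partial>lebesgue) \<le> ennreal (2 * h * (F q x + c))"
          using elim(1) q(1) c by blast
        show "\<exists>\<delta>>0. \<forall>h\<in>{0<..\<delta>}.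
          (\<integral>\<^sup>+v\<in>{-h..h}. ennreal (norm (f (x + v) - f x) powr p) \<partial>lebesgue) \<le> ennreal (\<epsilon> * h)"
        \<comment> \<open>\<open>F q\<close> is cut off outside \<open>[-\<pi>, \<pi>]\<close>, so \<open>[x - h, x + h]\<close> has to stay inside.\<close>
        proof (intro exI[of _ "min d (min (pi - x) (pi + x))"] conjI ballI)
          fix h assume h: "h \<in> {0<..min d (min (pi - x) (pi + x))}"
          have [measurable]: "(\<lambda>v. F q (x + v)) \<in> borel_measurable lebesgue"
            using F_int[of q] by (intro borel_measurable_lebesgue_translate) auto
          have "(\<integral>\<^sup>+v\<in>{-h..h}. ennreal (norm (f (x + v) - f x) powr p) \<partial>lebesgue)
            \<le> (\<integral>\<^sup>+v. ennreal (2 powr p) * (ennreal (F q (x + v)) * indicator {-h..h} v)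
                + ennreal (2 powr p * c) * indicator {-h..h} v \<partial>lebesgue)"
          proof (intro nn_integral_mono)
            fix v
            show "ennreal (norm (f (x + v) - f x) powr p) * indicator {-h..h} v
              \<le> ennreal (2 powr p) * (ennreal (F q (x + v)) * indicator {-h..h} v)
                + ennreal (2 powr p * c) * indicator {-h..h} v"
            proof (cases "v \<in> {-h..h}")
              case True
              then have "x + v \<in> {-pi..pi}" using h by auto
              then have F: "F q (x + v) = norm (f (x + v) - q) powr p" by (simp add: F_def)
              have "norm (f (x + v) - f x) powr p \<le> (norm (f (x + v) - q) + norm (f x - q)) powr p"
                using norm_triangle_ineq4[of "f (x + v) - q" "f x - q"] p
                by (intro powr_mono2) auto
              also have "\<dots> \<le> 2 powr p * (norm (f (x + v) - q) powr p + norm (f x - q) powr p)"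
                using p by (intro powr_add_le) auto
              also have "\<dots> \<le> 2 powr p * (F q (x + v) + c)"
                unfolding F using q' by (intro mult_left_mono add_mono) auto
              finally show ?thesis
                using True c F_nn[of q "x + v"]
                by (simp add: ennreal_mult[symmetric] ennreal_plus[symmetric] distrib_left del: ennreal_plus)
            qed auto
          qed
          also have "\<dots> = ennreal (2 powr p) * (\<integral>\<^sup>+v\<in>{-h..h}. ennreal (F q (x + v)) \<partial>lebesgue)
              + ennreal (2 powr p * c) * emeasure lebesgue {-h..h}"
            by (simp add: nn_integral_add nn_integral_cmult nn_integral_cmult_indicator)
          also have "\<dots> \<le> ennreal (2 powr p) * ennreal (2 * h * (F q x + c))
              + ennreal (2 powr p * c) * ennreal (2 * h)"
            using d(2)[of h] h by (intro add_mono mult_left_mono) auto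
          also have "\<dots> = ennreal (2 powr p * (2 * h * (F q x + c)) + 2 powr p * c * (2 * h))"
            using h c F_nn[of q x] by (simp add: ennreal_mult[symmetric] ennreal_plus[symmetric] del: ennreal_plus)
          also have "\<dots> \<le> ennreal (\<epsilon> * h)"
          proof (intro ennreal_leI)
            have "F q x \<le> c" using q' x by (simp add: F_def)
            then have "2 powr p * (2 * h * (F q x + c)) + 2 powr p * c * (2 * h)
              \<le> 2 powr p * (2 * h * (c + c)) + 2 powr p * c * (2 * h)"
              using h c by (intro add_mono mult_left_mono) auto
            also have "\<dots> = \<epsilon> * h" by (simp add: c_def field_simps)
            finally show "2 powr p * (2 * h * (F q x + c)) + 2 powr p * c * (2 * h) \<le> \<epsilon> * h" .
          qed
          finally show "(\<integral>\<^sup>+v\<in>{-h..h}. ennreal (norm (f (x + v) - f x) powr p) \<partial>lebesgue) \<le> ennreal (\<epsilon> * h)" .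
        qed (use d x in auto)
      qed
    qed
  qed
  then show ?thesis
    unfolding circle_def by (subst AE_restrict_space_iff) auto
qed

text \<open>For every \<open>\<kappa> > 0\<close> one has \<open>a \<le> \<kappa> + \<kappa>\<^sup>1\<^sup>-\<^sup>p a\<^sup>p\<close>, as the second summand alone dominates \<open>a\<close> when
  \<open>a > \<kappa>\<close>. Integrated with \<open>a = \<bar>f - f x\<bar>\<close>, this bounds the \<open>L\<^sup>1\<close> mean by a fixed small number plus
  a multiple of the \<open>L\<^sup>p\<close> mean.\<close>
lemma Lp_lebesgue_point_imp_L1:
  assumes lp: "Lp_lebesgue_point p f x" and p: "1 < p" and m: "f \<in> borel_measurable lebesgue"
  shows "Lp_lebesgue_point 1 f x"
  unfolding Lp_lebesgue_point_def
proof (intro allI impI)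
  fix \<epsilon> :: real assume \<epsilon>: "0 < \<epsilon>"
  define \<kappa> where "\<kappa> = \<epsilon> / 4"
  define c where "c = \<kappa> powr (1 - p)"
  have \<kappa>: "\<kappa> > 0" and c: "c > 0" using \<epsilon> by (auto simp: \<kappa>_def c_def)
  have "\<epsilon> / (2 * c) > 0" using \<epsilon> c by simp
  then obtain \<delta> where \<delta>: "\<delta> > 0" "\<And>h. h \<in> {0<..\<delta>} \<Longrightarrow>
      (\<integral>\<^sup>+v\<in>{-h..h}. ennreal (norm (f (x + v) - f x) powr p) \<partial>lebesgue) \<le> ennreal (\<epsilon> / (2 * c) * h)"
    using lp unfolding Lp_lebesgue_point_def by blast
  have [measurable]: "(\<lambda>v. f (x + v)) \<in> borel_measurable lebesgue"
    by (rule borel_measurable_lebesgue_translate[OF m])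
  have pointwise: "a \<le> \<kappa> + c * a powr p" if a: "0 \<le> a" for a
  proof (cases "a \<le> \<kappa>")
    case False
    then have "a = a powr p * a powr (1 - p)" using \<kappa> by (simp add: powr_add[symmetric])
    also have "\<dots> \<le> a powr p * c"
      unfolding c_def using False \<kappa> p by (intro mult_left_mono powr_mono2') auto
    finally show ?thesis using \<kappa> by (simp add: mult.commute)
  qed (use c in \<open>simp add: add_increasing2\<close>)
  show "\<exists>\<delta>>0. \<forall>h\<in>{0<..\<delta>}.
      (\<integral>\<^sup>+v\<in>{-h..h}. ennreal (norm (f (x + v) - f x) powr 1) \<partial>lebesgue) \<le> ennreal (\<epsilon> * h)"
  proof (intro exI[of _ \<delta>] conjI ballI)
    fix h assume h: "h \<in> {0<..\<delta>}"
    have "(\<integral>\<^sup>+v\<in>{-h..h}. ennreal (norm (f (x + v) - f x) powr 1) \<partial>lebesgue)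
        \<le> (\<integral>\<^sup>+v. ennreal \<kappa> * indicator {-h..h} v
            + ennreal c * (ennreal (norm (f (x + v) - f x) powr p) * indicator {-h..h} v) \<partial>lebesgue)"
      (is "_ \<le> (\<integral>\<^sup>+v. ?R v \<partial>lebesgue)")
    proof (intro nn_integral_mono)
      fix v
      have "norm (f (x + v) - f x) \<le> \<kappa> + c * norm (f (x + v) - f x) powr p"
        by (rule pointwise) simp
      then show "ennreal (norm (f (x + v) - f x) powr 1) * indicator {-h..h} v \<le> ?R v"
        using \<kappa> c by (auto simp: indicator_def ennreal_mult[symmetric] ennreal_plus[symmetric]
          simp del: ennreal_plus intro!: ennreal_leI)
    qed
    also have "\<dots> = ennreal \<kappa> * emeasure lebesgue {-h..h}
        + ennreal c * (\<integral>\<^sup>+v\<in>{-h..h}. ennreal (norm (f (x + v) - f x) powr p) \<partial>lebesgue)"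
      by (simp add: nn_integral_add nn_integral_cmult nn_integral_cmult_indicator)
    also have "\<dots> \<le> ennreal \<kappa> * ennreal (2 * h) + ennreal c * ennreal (\<epsilon> / (2 * c) * h)"
      using \<delta>(2)[OF h] h by (intro add_mono mult_left_mono) auto
    also have "\<dots> = ennreal (\<epsilon> * h)"
      using h \<kappa> c \<epsilon> by (simp add: ennreal_mult[symmetric] ennreal_plus[symmetric] \<kappa>_def field_simps del: ennreal_plus)
    finally show "(\<integral>\<^sup>+v\<in>{-h..h}. ennreal (norm (f (x + v) - f x) powr 1) \<partial>lebesgue) \<le> ennreal (\<epsilon> * h)" .
  qed (rule \<delta>(1))
qed

section \<open>Estimates for kernels on the line\<close>

lemma nn_integral_power_tail:
  fixes a q :: real
  assumes a: "0 < a" and q: "1 < q"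
  shows "(\<integral>\<^sup>+u\<in>{a..}. ennreal ((a / u) powr q) \<partial>lebesgue) = ennreal (a / (q - 1))"
proof -
  have "((\<lambda>u. a powr q * u powr (- q)) has_integral a powr q * (- (a powr (- q + 1)) / (- q + 1))) {a..}"
    using a q by (intro has_integral_mult_right has_integral_powr_to_inf) auto
  then have "(\<integral>\<^sup>+u. indicator {a..} u * ennreal (a powr q * u powr (- q)) \<partial>lborel)
      = ennreal (a powr q * (- (a powr (- q + 1)) / (- q + 1)))"
    using nn_integral_has_integral_lebesgue[of "{a..}" "\<lambda>u. a powr q * u powr (- q)"] a
    by (simp add: ennreal_mult' ennreal_indicator)
  also have "a powr q * (- (a powr (- q + 1)) / (- q + 1)) = a powr q * a powr (- q + 1) / (q - 1)"
    using q by (simp add: divide_simps) (simp add: algebra_simps)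
  also have "a powr q * a powr (- q + 1) = a"
    using a by (simp add: powr_add[symmetric])
  also have "(\<integral>\<^sup>+u. indicator {a..} u * ennreal (a powr q * u powr (- q)) \<partial>lborel)
      = (\<integral>\<^sup>+u\<in>{a..}. ennreal ((a / u) powr q) \<partial>lebesgue)"
    using a unfolding nn_integral_completion
    by (intro nn_integral_cong) (auto simp: indicator_def powr_divide powr_minus_divide)
  finally show ?thesis .
qed

text \<open>The profile \<open>min 1 (a / \<bar>u\<bar>)\<close> is, up to scaling, the least majorant of all kernels that satisfy
  a sup bound together with a bound on \<open>\<bar>u\<bar> k u\<close>.\<close>
lemma nn_integral_truncated_power:
  fixes a q :: real
  assumes a: "0 < a" and q: "1 < q"
  shows "(\<integral>\<^sup>+u. ennreal (min 1 (a / \<bar>u\<bar>) powr q) \<partial>lebesgue) \<le> ennreal (2 * a * (1 + 1 / (q - 1)))"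
proof -
  define T where "T u = ennreal ((a / u) powr q) * indicator {a..} u" for u
  have Tm [measurable]: "T \<in> borel_measurable lebesgue"
    unfolding T_def by measurable
  have [measurable]: "(\<lambda>u. T (- u)) \<in> borel_measurable lebesgue"
    using borel_measurable_lebesgue_reflect[OF Tm, of 0] by simp
  have "(\<integral>\<^sup>+u. ennreal (min 1 (a / \<bar>u\<bar>) powr q) \<partial>lebesgue)
      \<le> (\<integral>\<^sup>+u. indicator {-a..a} u + (T u + T (- u)) \<partial>lebesgue)"
  proof (intro nn_integral_mono)
    fix u
    consider "\<bar>u\<bar> \<le> a" | "u > a" | "u < - a" by linarith
    then show "ennreal (min 1 (a / \<bar>u\<bar>) powr q) \<le> indicator {-a..a} u + (T u + T (- u))"
    proof cases
      case 1
      have "min 1 (a / \<bar>u\<bar>) powr q \<le> 1 powr q" using a q by (intro powr_mono2) auto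
      then have "ennreal (min 1 (a / \<bar>u\<bar>) powr q) \<le> 1" by simp
      moreover have "u \<in> {-a..a}" using 1 by auto
      ultimately show ?thesis by (simp add: add_increasing2)
    next
      case 2
      then have "min 1 (a / \<bar>u\<bar>) = a / u" using a by (auto simp: min_def field_simps)
      with 2 show ?thesis by (simp add: T_def add_increasing add_increasing2)
    next
      case 3
      then have "min 1 (a / \<bar>u\<bar>) = a / (- u)" using a by (auto simp: min_def field_simps)
      with 3 show ?thesis by (simp add: T_def add_increasing add_increasing2)
    qed
  qed
  also have "\<dots> = ennreal (2 * a) + ((\<integral>\<^sup>+u. T u \<partial>lebesgue) + (\<integral>\<^sup>+u. T (- u) \<partial>lebesgue))"
    using a by (simp add: nn_integral_add)
  also have "(\<integral>\<^sup>+u. T (- u) \<partial>lebesgue) = (\<integral>\<^sup>+u. T u \<partial>lebesgue)"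
    using nn_integral_lebesgue_reflect[OF Tm, of 0] by simp
  also have "(\<integral>\<^sup>+u. T u \<partial>lebesgue) = ennreal (a / (q - 1))"
    unfolding T_def by (rule nn_integral_power_tail[OF assms])
  also have "ennreal (2 * a) + (ennreal (a / (q - 1)) + ennreal (a / (q - 1)))
      = ennreal (2 * a * (1 + 1 / (q - 1)))"
    using a q by (simp add: ennreal_plus[symmetric] algebra_simps del: ennreal_plus)
  finally show ?thesis .
qed

text \<open>A weighted form of Hoelder's inequality for a kernel with \<open>k u \<le> min N (S / \<bar>u\<bar>)\<close>. Write this
  majorant as \<open>N m u\<close> with \<open>m u = min 1 (a / \<bar>u\<bar>)\<close>, \<open>a = S / N\<close>, and compare \<open>G u\<close> with the threshold
  \<open>K u = (\<eta> / S) m u\<^bsup>1 / (p - 1)\<^esup>\<close>. Where \<open>G \<le> K\<close>, the product \<open>k G\<close> is at most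
  \<open>(N \<eta> / S) m\<^bsup>p / (p - 1)\<^esup>\<close>, whose integral is at most \<open>2 p \<eta>\<close>. Where \<open>G > K\<close>, one has
  \<open>G \<le> G\<^sup>p K\<^bsup>1 - p\<^esup>\<close>, and the exponent in \<open>K\<close> is the one for which \<open>N m K\<^bsup>1 - p\<^esup>\<close> is constant,
  equal to \<open>N S\<^bsup>p - 1\<^esup> \<eta>\<^bsup>1 - p\<^esup>\<close>. The factor \<open>N S\<^bsup>p - 1\<^esup>\<close> is exactly what \<open>\<Pi>\<^sub>p\<close> controls.\<close>
lemma kernel_near_bound:
  fixes k G :: "real \<Rightarrow> real"
  assumes [measurable]: "k \<in> borel_measurable lebesgue" "G \<in> borel_measurable lebesgue" "A \<in> sets lebesgue"
    and k0: "\<And>u. 0 \<le> k u" and G0: "\<And>u. 0 \<le> G u"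
    and k: "AE u in lebesgue. u \<in> A \<longrightarrow> k u \<le> N \<and> \<bar>u\<bar> * k u \<le> S"
    and N: "0 \<le> N" and S: "0 \<le> S" and p: "1 < p" and \<eta>: "0 < \<eta>"
  shows "(\<integral>\<^sup>+u\<in>A. ennreal (k u * G u) \<partial>lebesgue) \<le> ennreal (2 * p * \<eta>)
    + ennreal (N * S powr (p - 1) * \<eta> powr (1 - p)) * (\<integral>\<^sup>+u\<in>A. ennreal (G u powr p) \<partial>lebesgue)"
proof -
  have nz: "AE u in lebesgue. u \<noteq> (0::real)"
    by (rule AE_I'[of "{0}"]) (auto simp: negligible_iff_null_sets[symmetric])
  show ?thesis
    \<comment> \<open>In the degenerate case \<open>k\<close> vanishes almost everywhere on \<open>A\<close>, and the scale \<open>a = S / N\<close> and the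
      threshold would be zero or divide by zero.\<close>
  proof (cases "N = 0 \<or> S = 0")
    case True
    have "AE u in lebesgue. ennreal (k u * G u) * indicator A u = 0"
      using k nz
    proof eventually_elim
      case (elim u)
      show ?case
      proof (cases "u \<in> A")
        case True
        then have "k u \<le> 0"
          using elim \<open>N = 0 \<or> S = 0\<close> k0[of u] by (auto simp: mult_le_0_iff)
        then show ?thesis using k0[of u] by simp
      qed auto
    qed
    then have "(\<integral>\<^sup>+u\<in>A. ennreal (k u * G u) \<partial>lebesgue) = 0"
      by (subst nn_integral_0_iff_AE) auto
    then show ?thesis by simp
  next
    case False
    then have N: "N > 0" and S: "S > 0" using N S by auto
    define a where "a = S / N"
    define m where "m u = min 1 (a / \<bar>u\<bar>)" for u :: real
    define c where "c = N * S powr (p - 1) * \<eta> powr (1 - p)"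
    have a: "a > 0" using N S by (auto simp: a_def)
    have q: "1 < p / (p - 1)" using p by (simp add: field_simps)
    have [measurable]: "m \<in> borel_measurable lebesgue"
      unfolding m_def by measurable
    have c: "c \<ge> 0" using N by (simp add: c_def)
    have pointwise: "k u * G u \<le> N * \<eta> / S * m u powr (p / (p - 1)) + c * G u powr p"
      if ku: "k u \<le> N" "\<bar>u\<bar> * k u \<le> S" and u: "u \<noteq> 0" for u
    proof -
      define K where "K = \<eta> / S * m u powr (1 / (p - 1))"
      have m: "m u > 0" using a u by (auto simp: m_def)
      have K: "K > 0" using \<eta> S m by (auto simp: K_def)
      have km: "k u \<le> N * m u"
        using ku u N by (auto simp: m_def a_def min_def field_simps)
      show ?thesis
      proof (cases "G u \<le> K")
        case True
        have "k u * G u \<le> (N * m u) * K"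
          using km True k0 G0 m N by (intro mult_mono) auto
        also have "\<dots> = N * \<eta> / S * (m u powr 1 * m u powr (1 / (p - 1)))"
          using m by (simp add: K_def)
        also have "m u powr 1 * m u powr (1 / (p - 1)) = m u powr (p / (p - 1))"
          using p by (subst powr_add[symmetric]) (simp add: field_simps)
        finally show ?thesis using c by (simp add: add_increasing2)
      next
        case False
        then have Gp: "G u > 0" using K by simp
        have "G u = G u powr p * G u powr (1 - p)"
          using Gp by (simp add: powr_add[symmetric])
        also have "\<dots> \<le> G u powr p * K powr (1 - p)"
          using False K p by (intro mult_left_mono powr_mono2') auto
        finally have "k u * G u \<le> (N * m u) * (G u powr p * K powr (1 - p))"
          using km k0[of u] G0[of u] m N by (intro mult_mono) auto
        also have "K powr (1 - p) = (\<eta> / S) powr (1 - p) * (m u powr (1 / (p - 1))) powr (1 - p)"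
          unfolding K_def by (rule powr_mult)
        also have "(m u powr (1 / (p - 1))) powr (1 - p) = m u powr (- 1)"
        proof -
          have "1 / (p - 1) * (1 - p) = - 1" using p by (simp add: field_simps)
          then show ?thesis by (simp only: powr_powr)
        qed
        also have "\<dots> = 1 / m u" using m by (simp add: powr_minus_divide)
        also have "(\<eta> / S) powr (1 - p) = \<eta> powr (1 - p) * S powr (p - 1)"
          using \<eta> S by (simp add: powr_divide powr_minus_divide[of S "p - 1", simplified])
        also have "(N * m u) * (G u powr p * (\<eta> powr (1 - p) * S powr (p - 1) * (1 / m u)))
            = c * G u powr p"
          using m by (simp add: c_def)
        finally show ?thesis using N \<eta> S m by (simp add: add_increasing)
      qed
    qed
    have "(\<integral>\<^sup>+u\<in>A. ennreal (k u * G u) \<partial>lebesgue)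
      \<le> (\<integral>\<^sup>+u. ennreal (N * \<eta> / S) * ennreal (m u powr (p / (p - 1)))
          + ennreal c * (ennreal (G u powr p) * indicator A u) \<partial>lebesgue)"
    proof (rule nn_integral_mono_AE, use k nz in eventually_elim)
      case (elim u)
      show ?case
      proof (cases "u \<in> A")
        case True
        then have "k u * G u \<le> N * \<eta> / S * m u powr (p / (p - 1)) + c * G u powr p"
          using elim by (intro pointwise) auto
        then show ?thesis
          using True N S \<eta> c by (simp add: ennreal_mult[symmetric] ennreal_plus[symmetric] del: ennreal_plus)
      qed auto
    qed
    also have "\<dots> = ennreal (N * \<eta> / S) * (\<integral>\<^sup>+u. ennreal (m u powr (p / (p - 1))) \<partial>lebesgue)
        + ennreal c * (\<integral>\<^sup>+u\<in>A. ennreal (G u powr p) \<partial>lebesgue)"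
      by (simp add: nn_integral_add nn_integral_cmult)
    also have "(\<integral>\<^sup>+u. ennreal (m u powr (p / (p - 1))) \<partial>lebesgue) \<le> ennreal (2 * a * (1 + 1 / (p / (p - 1) - 1)))"
      unfolding m_def by (rule nn_integral_truncated_power[OF a q])
    also have "ennreal (N * \<eta> / S) * ennreal (2 * a * (1 + 1 / (p / (p - 1) - 1))) = ennreal (2 * p * \<eta>)"
    proof -
      have "1 + 1 / (p / (p - 1) - 1) = p" using p by (simp add: field_simps)
      then show ?thesis using N S \<eta> by (simp add: ennreal_mult'[symmetric] a_def mult_ac)
    qed
    finally show ?thesis unfolding c_def by (simp add: add_right_mono mult_left_mono)
  qed
qed

lemma sigma_finite_lebesgue: "sigma_finite_measure (lebesgue :: real measure)"
proof
  obtain A :: "real set set" where A: "countable A" "A \<subseteq> sets lborel" "\<Union>A = space lborel"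
    "\<forall>a\<in>A. emeasure lborel a \<noteq> \<infinity>"
    using lborel.sigma_finite_countable by blast
  show "\<exists>A::real set set. countable A \<and> A \<subseteq> sets lebesgue \<and> \<Union>A = space lebesgue \<and>
      (\<forall>a\<in>A. emeasure lebesgue a \<noteq> \<infinity>)"
    using A by (intro exI[of _ A]) (auto simp: subset_iff)
qed

text \<open>If \<open>k u \<le> M w\<close> for all \<open>w < \<bar>u\<bar>\<close>, then \<open>k u\<close> is at most the mean of \<open>M\<close> over
  \<open>[\<bar>u\<bar> / 2, \<bar>u\<bar>]\<close>. Insert this mean and exchange the integrals: for fixed \<open>w\<close> the inner integral is at
  most \<open>2 / w\<close> times the integral of \<open>H\<close> over \<open>w < \<bar>u\<bar> < 2 w\<close>, hence at most \<open>2 c\<close>, so that the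
  integral of \<open>M\<close> remains. Only \<open>w > l\<close> occur, because \<open>\<bar>u\<bar> \<ge> 2 l\<close>.\<close>
lemma kernel_far_bound:
  fixes k H M :: "real \<Rightarrow> ennreal" and c D l :: real
  assumes [measurable]: "H \<in> borel_measurable lebesgue" "M \<in> borel_measurable lebesgue"
    and l: "0 < l" and c: "0 \<le> c"
    and k: "AE u in lebesgue. \<bar>u\<bar> \<le> D \<longrightarrow> (\<forall>w\<in>{0<..<\<bar>u\<bar>}. k u \<le> M w)"
    and H: "\<And>w. w \<in> {l..D} \<Longrightarrow> (\<integral>\<^sup>+u\<in>{-2*w..2*w}. H u \<partial>lebesgue) \<le> ennreal (c * w)"
  shows "(\<integral>\<^sup>+u\<in>{u. 2 * l \<le> \<bar>u\<bar> \<and> \<bar>u\<bar> \<le> D}. k u * H u \<partial>lebesgue)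
    \<le> ennreal (2 * c) * (\<integral>\<^sup>+w\<in>{0..D}. M w \<partial>lebesgue)"
proof -
  interpret sigma_finite_measure "lebesgue :: real measure"
    by (rule sigma_finite_lebesgue)
  interpret P: pair_sigma_finite "lebesgue :: real measure" "lebesgue :: real measure" ..
  define Q where "Q w u = indicator {l..D} w * ennreal (2 / w) * M w * (H u * indicator {-2*w..2*w} u)" for w u
  have [measurable]: "(\<lambda>(w, u). Q w u) \<in> borel_measurable (lebesgue \<Otimes>\<^sub>M lebesgue)"
  proof -
    have eq: "indicator {-2*w..2*w} u = (if -2*w \<le> u \<and> u \<le> 2*w then 1 else 0 :: ennreal)" for w u :: real
      by (auto simp: indicator_def)
    show ?thesis unfolding Q_def eq by measurable
  qed
  have "(\<integral>\<^sup>+u\<in>{u. 2 * l \<le> \<bar>u\<bar> \<and> \<bar>u\<bar> \<le> D}. k u * H u \<partial>lebesgue)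
      \<le> (\<integral>\<^sup>+u. \<integral>\<^sup>+w. Q w u \<partial>lebesgue \<partial>lebesgue)"
  proof (rule nn_integral_mono_AE, use k in eventually_elim)
    case (elim u)
    show ?case
    proof (cases "2 * l \<le> \<bar>u\<bar> \<and> \<bar>u\<bar> \<le> D")
      case True
      define U where "U = {\<bar>u\<bar> / 2<..<\<bar>u\<bar>}"
      have u: "\<bar>u\<bar> > 0" using True l by auto
      have "k u * H u = ennreal (2 / \<bar>u\<bar>) * (k u * H u) * emeasure lebesgue U"
      proof -
        have "emeasure lebesgue U = ennreal (\<bar>u\<bar> / 2)"
          using u by (simp add: U_def)
        moreover have "ennreal (2 / \<bar>u\<bar>) * ennreal (\<bar>u\<bar> / 2) = 1"
          using u by (simp add: ennreal_mult[symmetric])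
        ultimately show ?thesis by (metis mult.assoc mult.commute mult_1)
      qed
      also have "\<dots> = (\<integral>\<^sup>+w. ennreal (2 / \<bar>u\<bar>) * (k u * H u) * indicator U w \<partial>lebesgue)"
        by (subst nn_integral_cmult_indicator) (auto simp: U_def)
      also have "\<dots> \<le> (\<integral>\<^sup>+w. Q w u \<partial>lebesgue)"
      proof (intro nn_integral_mono)
        fix w
        show "ennreal (2 / \<bar>u\<bar>) * (k u * H u) * indicator U w \<le> Q w u"
        proof (cases "w \<in> U")
          case True
          with \<open>2 * l \<le> \<bar>u\<bar> \<and> \<bar>u\<bar> \<le> D\<close> l
          have w: "w \<in> {l..D}" "u \<in> {-2*w..2*w}" "0 < w" "w < \<bar>u\<bar>" by (auto simp: U_def)
          have "ennreal (2 / \<bar>u\<bar>) \<le> ennreal (2 / w)"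
            using w by (intro ennreal_leI divide_left_mono) auto
          moreover have "k u \<le> M w" using elim w \<open>2 * l \<le> \<bar>u\<bar> \<and> \<bar>u\<bar> \<le> D\<close> by auto
          ultimately have "ennreal (2 / \<bar>u\<bar>) * (k u * H u) \<le> ennreal (2 / w) * (M w * H u)"
            by (intro mult_mono) auto
          then show ?thesis using w True by (simp add: Q_def mult.assoc)
        qed auto
      qed
      finally show ?thesis using True by simp
    qed auto
  qed
  also have "\<dots> = (\<integral>\<^sup>+w. \<integral>\<^sup>+u. Q w u \<partial>lebesgue \<partial>lebesgue)"
    by (rule P.Fubini') measurable
  also have "\<dots> \<le> (\<integral>\<^sup>+w. ennreal (2 * c) * (M w * indicator {0..D} w) \<partial>lebesgue)"
  proof (intro nn_integral_mono)
    fix w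
    show "(\<integral>\<^sup>+u. Q w u \<partial>lebesgue) \<le> ennreal (2 * c) * (M w * indicator {0..D} w)"
    proof (cases "w \<in> {l..D}")
      case True
      then have w: "w > 0" using l by auto
      have "(\<integral>\<^sup>+u. Q w u \<partial>lebesgue) = ennreal (2 / w) * M w * (\<integral>\<^sup>+u\<in>{-2*w..2*w}. H u \<partial>lebesgue)"
        unfolding Q_def using True by (simp add: nn_integral_cmult)
      also have "\<dots> \<le> ennreal (2 / w) * M w * ennreal (c * w)"
        using H[OF True] by (intro mult_left_mono) auto
      also have "\<dots> = ennreal (2 / w) * ennreal (c * w) * M w" by (simp add: mult_ac)
      also have "ennreal (2 / w) * ennreal (c * w) = ennreal (2 * c)"
        using w c by (simp add: ennreal_mult[symmetric])
      finally show ?thesis using True w by simp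
    qed (simp add: Q_def)
  qed
  also have "\<dots> = ennreal (2 * c) * (\<integral>\<^sup>+w\<in>{0..D}. M w \<partial>lebesgue)"
    by (simp add: nn_integral_cmult)
  finally show ?thesis .
qed

section \<open>Periodic functions and reflection on the circle\<close>

lemma int_translate_into_period:
  fixes x :: real
  obtains n :: int where "x - of_int n * (2 * pi) \<in> {-pi..<pi}"
proof
  define y where "y = (x + pi) / (2 * pi)"
  have "of_int \<lfloor>y\<rfloor> \<le> y" "y < of_int \<lfloor>y\<rfloor> + 1" by linarith+
  then have "of_int \<lfloor>y\<rfloor> * (2 * pi) \<le> y * (2 * pi)" "y * (2 * pi) < (of_int \<lfloor>y\<rfloor> + 1) * (2 * pi)"
    by simp_all
  moreover have "y * (2 * pi) = x + pi" by (simp add: y_def)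
  ultimately show "x - of_int \<lfloor>y\<rfloor> * (2 * pi) \<in> {-pi..<pi}"
    by (simp add: distrib_right)
qed

lemma periodic_borel_measurable_lebesgue:
  fixes f :: "real \<Rightarrow> 'a::topological_space"
  assumes "periodic_fun_simple f (2 * pi)" and f: "f \<in> borel_measurable circle"
  shows "f \<in> borel_measurable lebesgue"
proof (rule measurableI)
  interpret periodic_fun_simple f "2 * pi" by fact
  fix S :: "'a set" assume S: "S \<in> sets borel"
  define A where "A = {x \<in> {-pi..pi}. f x \<in> S}"
  have "f -` S \<inter> space circle \<in> sets circle"
    using f S by (rule measurable_sets)
  then have A: "A \<in> sets lebesgue"
    by (auto simp: circle_def sets_restrict_space_iff A_def vimage_def Int_def conj_commute)
  have "f -` S \<inter> space lebesgue = (\<Union>n::int. (\<lambda>x. - of_int n * (2 * pi) + 1 * x) -` A \<inter> space lebesgue)"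
  proof (intro equalityI subsetI)
    fix x assume "x \<in> f -` S \<inter> space lebesgue"
    moreover obtain n :: int where "x - of_int n * (2 * pi) \<in> {-pi..<pi}"
      by (rule int_translate_into_period)
    ultimately have "- of_int n * (2 * pi) + 1 * x \<in> A"
      using minus_of_int[of x n] by (auto simp: A_def)
    then show "x \<in> (\<Union>n::int. (\<lambda>x. - of_int n * (2 * pi) + 1 * x) -` A \<inter> space lebesgue)" by auto
  next
    fix x assume "x \<in> (\<Union>n::int. (\<lambda>x. - of_int n * (2 * pi) + 1 * x) -` A \<inter> space lebesgue)"
    then obtain n :: int where "- of_int n * (2 * pi) + 1 * x \<in> A" by auto
    then show "x \<in> f -` S \<inter> space lebesgue"
      using minus_of_int[of x n] by (auto simp: A_def)
  qed
  also have "\<dots> \<in> sets lebesgue"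
    by (intro sets.countable_UN image_subsetI measurable_sets[OF _ A] measurable_lebesgue_affine) simp
  finally show "f -` S \<inter> space lebesgue \<in> sets lebesgue" .
qed simp

text \<open>Moving the window from \<open>[b, b + T)\<close> to \<open>[b + d, b + d + T)\<close> with \<open>0 \<le> d \<le> T\<close> removes \<open>[b, b + d)\<close>
  and adds its translate by \<open>T\<close>, which carries the same integral. A translation by a multiple of
  \<open>T\<close> reduces every window to one of these.\<close>
lemma nn_integral_shift_period:
  fixes H :: "real \<Rightarrow> ennreal"
  assumes "periodic_fun_simple H T" and T: "0 < T" and [measurable]: "H \<in> borel_measurable lebesgue"
  shows "(\<integral>\<^sup>+x\<in>{a..<a + T}. H x \<partial>lebesgue) = (\<integral>\<^sup>+x\<in>{b..<b + T}. H x \<partial>lebesgue)"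
proof -
  interpret periodic_fun_simple H T by fact
  define A where "A a = (\<integral>\<^sup>+x\<in>{a..<a + T}. H x \<partial>lebesgue)" for a
  have split: "(\<integral>\<^sup>+x\<in>{a..<c}. H x \<partial>lebesgue)
      = (\<integral>\<^sup>+x\<in>{a..<b}. H x \<partial>lebesgue) + (\<integral>\<^sup>+x\<in>{b..<c}. H x \<partial>lebesgue)"
    if "a \<le> b" "b \<le> c" for a b c
    using that by (subst nn_integral_add[symmetric]) (auto intro!: nn_integral_cong simp: indicator_def)
  have translate: "(\<integral>\<^sup>+x\<in>{a + of_int n * T..<c + of_int n * T}. H x \<partial>lebesgue)
      = (\<integral>\<^sup>+x\<in>{a..<c}. H x \<partial>lebesgue)" for a c and n :: int
  proof -
    have "(\<integral>\<^sup>+x\<in>{a + of_int n * T..<c + of_int n * T}. H x \<partial>lebesgue)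
      = (\<integral>\<^sup>+x. H (of_int n * T + x) * indicator {a + of_int n * T..<c + of_int n * T} (of_int n * T + x) \<partial>lebesgue)"
      by (rule nn_integral_lebesgue_translate[symmetric]) measurable
    also have "\<dots> = (\<integral>\<^sup>+x\<in>{a..<c}. H x \<partial>lebesgue)"
      using plus_of_int[of _ n] by (intro nn_integral_cong) (auto simp: indicator_def add.commute)
    finally show ?thesis .
  qed
  have step: "A (b + d) = A b" if "0 \<le> d" "d \<le> T" for b d
  proof -
    have "A (b + d) = (\<integral>\<^sup>+x\<in>{b + d..<b + T}. H x \<partial>lebesgue) + (\<integral>\<^sup>+x\<in>{b + T..<b + d + T}. H x \<partial>lebesgue)"
      unfolding A_def using that by (intro split) auto
    also have "(\<integral>\<^sup>+x\<in>{b + T..<b + d + T}. H x \<partial>lebesgue) = (\<integral>\<^sup>+x\<in>{b..<b + d}. H x \<partial>lebesgue)"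
      using translate[of b 1 "b + d"] by simp
    also have "(\<integral>\<^sup>+x\<in>{b + d..<b + T}. H x \<partial>lebesgue) + \<dots> = A b"
      unfolding A_def using that split[of b "b + d" "b + T"] by (simp add: add.commute)
    finally show ?thesis .
  qed
  have "A a = A 0" for a
  proof -
    define n where "n = \<lfloor>a / T\<rfloor>"
    have "of_int n \<le> a / T" "a / T < of_int n + 1" unfolding n_def by linarith+
    then have "of_int n * T \<le> a" "a \<le> of_int n * T + T" using T by (simp_all add: field_simps)
    then have "A a = A (of_int n * T)" using step[of "a - of_int n * T" "of_int n * T"] by simp
    also have "\<dots> = A 0" unfolding A_def using translate[of 0 n T] by (simp add: add.commute)
    finally show ?thesis .
  qed
  then show ?thesis unfolding A_def by metis
qed

lemma nn_integral_circle:
  "(\<integral>\<^sup>+t. H t \<partial>circle) = (\<integral>\<^sup>+t\<in>{-pi..pi}. H t \<partial>lebesgue)"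
  unfolding circle_def by (simp add: nn_integral_restrict_space)

text \<open>The reflection maps \<open>[-\<pi>, \<pi>]\<close> to \<open>[y - \<pi>, y + \<pi>]\<close>, which is again a full period.\<close>
lemma nn_integral_circle_reflect:
  fixes H :: "real \<Rightarrow> ennreal"
  assumes H: "periodic_fun_simple H (2 * pi)" and [measurable]: "H \<in> borel_measurable lebesgue"
  shows "(\<integral>\<^sup>+t. H (y - t) \<partial>circle) = (\<integral>\<^sup>+t. H t \<partial>circle)"
proof -
  have half_open: "(\<integral>\<^sup>+t\<in>{a..b}. H t \<partial>lebesgue) = (\<integral>\<^sup>+t\<in>{a..<b}. H t \<partial>lebesgue)" for a b
  proof (rule nn_integral_cong_AE)
    have "AE t in lebesgue. t \<noteq> b"
      by (rule AE_I'[of "{b}"]) (auto simp: negligible_iff_null_sets[symmetric])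
    then show "AE t in lebesgue. H t * indicator {a..b} t = H t * indicator {a..<b} t"
      by eventually_elim (auto simp: indicator_def)
  qed
  have "(\<integral>\<^sup>+t. H (y - t) \<partial>circle)
      = (\<integral>\<^sup>+t. H (y - t) * indicator {y - pi..y + pi} (y - t) \<partial>lebesgue)"
    unfolding nn_integral_circle by (intro nn_integral_cong) (auto simp: indicator_def)
  also have "\<dots> = (\<integral>\<^sup>+t\<in>{y - pi..y + pi}. H t \<partial>lebesgue)"
    by (rule nn_integral_lebesgue_reflect) measurable
  also have "\<dots> = (\<integral>\<^sup>+t\<in>{-pi..pi}. H t \<partial>lebesgue)"
    unfolding half_open using nn_integral_shift_period[OF H, of "y - pi" "-pi"] by (simp add: algebra_simps)
  finally show ?thesis by (simp add: nn_integral_circle)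
qed

lemma borel_measurable_circle:
  "f \<in> borel_measurable lebesgue \<Longrightarrow> f \<in> borel_measurable circle"
  unfolding circle_def by (rule measurable_restrict_space1)

lemma integrable_circle_reflect:
  fixes h :: "real \<Rightarrow> 'a::{banach, second_countable_topology}"
  assumes h: "periodic_fun_simple h (2 * pi)" and m: "h \<in> borel_measurable lebesgue" and i: "integrable circle h"
  shows "integrable circle (\<lambda>t. h (y - t))"
proof (rule integrableI_bounded)
  interpret periodic_fun_simple h "2 * pi" by fact
  show "(\<lambda>t. h (y - t)) \<in> borel_measurable circle"
    by (rule borel_measurable_circle[OF borel_measurable_lebesgue_reflect[OF m]])
  have "(\<integral>\<^sup>+t. ennreal (norm (h (y - t))) \<partial>circle) = (\<integral>\<^sup>+t. ennreal (norm (h t)) \<partial>circle)"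
    using m by (intro nn_integral_circle_reflect[of "\<lambda>t. ennreal (norm (h t))"])
      (auto simp: periodic_fun_simple_def plus_period)
  also have "\<dots> < \<infinity>" using i by (simp add: integrable_iff_bounded)
  finally show "(\<integral>\<^sup>+t. ennreal (norm (h (y - t))) \<partial>circle) < \<infinity>" .
qed

text \<open>A complex integral is made of four integrals of nonnegative periodic functions, the positive and
  negative parts of the real and the imaginary part, to which the invariance for
  nonnegative functions applies.\<close>
lemma integral_circle_reflect:
  fixes h :: "real \<Rightarrow> complex"
  assumes h: "periodic_fun_simple h (2 * pi)" and m: "h \<in> borel_measurable lebesgue" and i: "integrable circle h"
  shows "(LINT t|circle. h (y - t)) = (LINT t|circle. h t)"
proof -
  interpret periodic_fun_simple h "2 * pi" by fact
  have real: "(LINT t|circle. F (h (y - t))) = (LINT t|circle. F (h t))"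
    if [measurable]: "F \<in> borel_measurable borel" and i1: "integrable circle (\<lambda>t. F (h t))"
      and i2: "integrable circle (\<lambda>t. F (h (y - t)))"
    for F :: "complex \<Rightarrow> real"
  proof -
    have "(\<integral>\<^sup>+t. ennreal (F (h (y - t))) \<partial>circle) = (\<integral>\<^sup>+t. ennreal (F (h t)) \<partial>circle)"
      using m by (intro nn_integral_circle_reflect[of "\<lambda>t. ennreal (F (h t))"])
        (auto simp: periodic_fun_simple_def plus_period)
    moreover have "(\<integral>\<^sup>+t. ennreal (- F (h (y - t))) \<partial>circle) = (\<integral>\<^sup>+t. ennreal (- F (h t)) \<partial>circle)"
      using m by (intro nn_integral_circle_reflect[of "\<lambda>t. ennreal (- F (h t))"])
        (auto simp: periodic_fun_simple_def plus_period)
    ultimately show ?thesis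
      using i1 i2 by (simp add: real_lebesgue_integral_def)
  qed
  have i': "integrable circle (\<lambda>t. h (y - t))" by (rule integrable_circle_reflect[OF assms])
  show ?thesis
  proof (rule complex_eqI)
    show "Re (LINT t|circle. h (y - t)) = Re (LINT t|circle. h t)"
      using real[of Re, OF _ integrable_Re[OF i] integrable_Re[OF i']]
      by (simp only: integral_Re[OF i] integral_Re[OF i'] borel_measurable_Re)
    show "Im (LINT t|circle. h (y - t)) = Im (LINT t|circle. h t)"
      using real[of Im, OF _ integrable_Im[OF i] integrable_Im[OF i']]
      by (simp only: integral_Im[OF i] integral_Im[OF i'] borel_measurable_Im)
  qed
qed

section \<open>The majorant of a kernel\<close>

lemma annulus_in_sets_lebesgue [measurable]:
  "{t. \<bar>x\<bar> \<le> \<bar>t\<bar> \<and> \<bar>t\<bar> \<le> c} \<in> sets lebesgue" for x c :: real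
proof -
  have "closed {t::real. \<bar>x\<bar> \<le> \<bar>t\<bar> \<and> \<bar>t\<bar> \<le> c}"
    by (intro closed_Collect_conj closed_Collect_le continuous_intros)
  then show ?thesis by (simp add: borel_closed)
qed

lemma majorant_antimono:
  assumes [measurable]: "g \<in> borel_measurable lebesgue" and le: "\<bar>w\<bar> \<le> \<bar>q\<bar>"
  shows "majorant g q \<le> majorant g w"
proof -
  let ?A = "\<lambda>x::real. {t. \<bar>x\<bar> \<le> \<bar>t\<bar> \<and> \<bar>t\<bar> \<le> pi}"
  have A: "?A x \<in> sets lebesgue" for x by (rule annulus_in_sets_lebesgue)
  have "AE t in lebesgue_on (?A w). ennreal (norm (g t)) \<le> majorant g w"
    unfolding majorant_def by (rule esssup_AE)
  then have "AE t in lebesgue. t \<in> ?A w \<longrightarrow> ennreal (norm (g t)) \<le> majorant g w"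
    using A by (subst (asm) AE_restrict_space_iff) auto
  then have "AE t in lebesgue. t \<in> ?A q \<longrightarrow> ennreal (norm (g t)) \<le> majorant g w"
    by eventually_elim (use le in auto)
  then have "AE t in lebesgue_on (?A q). ennreal (norm (g t)) \<le> majorant g w"
    using A by (subst AE_restrict_space_iff) auto
  then show ?thesis
    unfolding majorant_def[of g q] by (intro esssup_I measurable_restrict_space1) auto
qed

text \<open>By monotonicity in \<open>\<bar>w\<bar>\<close>, the superlevel sets are intervals.\<close>
lemma borel_measurable_majorant:
  assumes g: "g \<in> borel_measurable lebesgue"
  shows "majorant g \<in> borel_measurable lebesgue"
proof (rule borel_measurableI_greater)
  fix a
  have "is_interval {w. a < majorant g w}"
    unfolding is_interval_1
  proof clarify
    fix u v x assume *: "a < majorant g u" "a < majorant g v" "u \<le> x" "x \<le> v"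
    then have "\<bar>x\<bar> \<le> \<bar>u\<bar> \<or> \<bar>x\<bar> \<le> \<bar>v\<bar>" by linarith
    then show "a < majorant g x" using * majorant_antimono[OF g] less_le_trans by blast
  qed
  then have "{w. a < majorant g w} \<in> sets borel" by (rule real_interval_borel_measurable)
  then show "{w \<in> space lebesgue. a < majorant g w} \<in> sets lebesgue" by simp
qed

text \<open>The majorant is an essential supremum, so a fixed \<open>w\<close> gives the inequality only off a null set
  depending on \<open>w\<close>. Rational \<open>w\<close> give a common null set, and a real \<open>w < \<bar>u\<bar>\<close> is followed by a rational
  between \<open>w\<close> and \<open>\<bar>u\<bar>\<close>. The point \<open>w = \<bar>u\<bar>\<close> is excluded for this reason: the majorant may jump
  there.\<close>
lemma AE_le_majorant:
  assumes [measurable]: "g \<in> borel_measurable lebesgue"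
  shows "AE u in lebesgue. \<bar>u\<bar> \<le> pi \<longrightarrow> (\<forall>w\<in>{0<..<\<bar>u\<bar>}. ennreal (norm (g u)) \<le> majorant g w)"
proof -
  let ?A = "\<lambda>x::real. {t. \<bar>x\<bar> \<le> \<bar>t\<bar> \<and> \<bar>t\<bar> \<le> pi}"
  have "AE t in lebesgue. t \<in> ?A q \<longrightarrow> ennreal (norm (g t)) \<le> majorant g q" for q
  proof -
    have "?A q \<in> sets lebesgue" by (rule annulus_in_sets_lebesgue)
    moreover have "AE t in lebesgue_on (?A q). ennreal (norm (g t)) \<le> majorant g q"
      unfolding majorant_def by (rule esssup_AE)
    ultimately show ?thesis by (subst (asm) AE_restrict_space_iff) auto
  qed
  then have "AE t in lebesgue. \<forall>q\<in>\<rat>. t \<in> ?A q \<longrightarrow> ennreal (norm (g t)) \<le> majorant g q"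
    by (subst AE_ball_countable) (auto simp: countable_rat)
  then show ?thesis
  proof eventually_elim
    case (elim u)
    show ?case
    proof (intro impI ballI)
      fix w assume u: "\<bar>u\<bar> \<le> pi" and w: "w \<in> {0<..<\<bar>u\<bar>}"
      obtain q where q: "q \<in> \<rat>" "w < q" "q < \<bar>u\<bar>" using Rats_dense_in_real[of w "\<bar>u\<bar>"] w by auto
      then have "ennreal (norm (g u)) \<le> majorant g q" using elim u w by auto
      also have "\<dots> \<le> majorant g w" using q w by (intro majorant_antimono) auto
      finally show "ennreal (norm (g u)) \<le> majorant g w" .
    qed
  qed
qed

lemma AE_le_Linf_norm:
  assumes g: "g \<in> Linf_circle"
  shows "AE u in lebesgue. \<bar>u\<bar> \<le> pi \<longrightarrow> norm (g u) \<le> enn2real (Linf_norm g)"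
proof -
  have "AE u in circle. ennreal (norm (g u)) \<le> Linf_norm g"
    unfolding Linf_norm_def by (rule esssup_AE)
  then have "AE u in lebesgue. u \<in> {-pi..pi} \<longrightarrow> ennreal (norm (g u)) \<le> Linf_norm g"
    unfolding circle_def by (subst (asm) AE_restrict_space_iff) auto
  then show ?thesis
  proof eventually_elim
    case (elim u)
    show ?case
    proof
      assume "\<bar>u\<bar> \<le> pi"
      then have "ennreal (norm (g u)) \<le> Linf_norm g" using elim by auto
      then have "enn2real (ennreal (norm (g u))) \<le> enn2real (Linf_norm g)"
        using g by (intro enn2real_mono) (auto simp: Linf_circle_def)
      then show "norm (g u) \<le> enn2real (Linf_norm g)" by simp
    qed
  qed
qed

lemma Linf_circle_lebesgue_measurable:
  "g \<in> Linf_circle \<Longrightarrow> g \<in> borel_measurable lebesgue"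
  unfolding Linf_circle_def
  by (elim CollectE conjE) (rule periodic_borel_measurable_lebesgue; assumption)

lemma phi_star_finite:
  assumes g: "g \<in> Linf_circle"
  shows "phi_star g < \<infinity>"
proof -
  note [measurable] = Linf_circle_lebesgue_measurable[OF g]
  have "majorant g x \<le> ennreal (enn2real (Linf_norm g))" for x
  proof -
    have "{t. \<bar>x\<bar> \<le> \<bar>t\<bar> \<and> \<bar>t\<bar> \<le> pi} \<in> sets lebesgue" by (rule annulus_in_sets_lebesgue)
    moreover have "AE t in lebesgue. t \<in> {t. \<bar>x\<bar> \<le> \<bar>t\<bar> \<and> \<bar>t\<bar> \<le> pi} \<longrightarrow>
        ennreal (norm (g t)) \<le> ennreal (enn2real (Linf_norm g))"
      using AE_le_Linf_norm[OF g] by eventually_elim (auto intro: ennreal_leI)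
    ultimately have "AE t in lebesgue_on {t. \<bar>x\<bar> \<le> \<bar>t\<bar> \<and> \<bar>t\<bar> \<le> pi}.
        ennreal (norm (g t)) \<le> ennreal (enn2real (Linf_norm g))"
      by (subst AE_restrict_space_iff) auto
    then show ?thesis
      unfolding majorant_def by (intro esssup_I measurable_restrict_space1) auto
  qed
  then have "phi_star g \<le> ennreal pi * ennreal (enn2real (Linf_norm g))"
    unfolding phi_star_def by (intro SUP_least mult_mono ennreal_leI) auto
  also have "\<dots> < \<infinity>" by (simp add: ennreal_mult_less_top)
  finally show ?thesis .
qed

text \<open>The bound \<open>w \<bar>g u\<bar> \<le> \<phi>\<^sub>*\<close> holds for all \<open>w < \<bar>u\<bar>\<close>; let \<open>w\<close> tend to \<open>\<bar>u\<bar>\<close>.\<close>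
lemma AE_le_phi_star:
  assumes g: "g \<in> Linf_circle"
  shows "AE u in lebesgue. \<bar>u\<bar> \<le> pi \<longrightarrow> \<bar>u\<bar> * norm (g u) \<le> enn2real (phi_star g)"
  using AE_le_majorant[OF Linf_circle_lebesgue_measurable[OF g]]
proof eventually_elim
  case (elim u)
  show ?case
  proof
    assume u: "\<bar>u\<bar> \<le> pi"
    have le: "w * norm (g u) \<le> enn2real (phi_star g)" if w: "w \<in> {0<..<\<bar>u\<bar>}" for w
    proof -
      have "ennreal (w * norm (g u)) = ennreal \<bar>w\<bar> * ennreal (norm (g u))"
        using w by (simp add: ennreal_mult)
      also have "\<dots> \<le> ennreal \<bar>w\<bar> * majorant g w"
        using elim u w by (intro mult_left_mono) auto
      also have "\<dots> \<le> phi_star g"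
        unfolding phi_star_def using u w by (intro SUP_upper) auto
      finally have "enn2real (ennreal (w * norm (g u))) \<le> enn2real (phi_star g)"
        using phi_star_finite[OF g] by (intro enn2real_mono) auto
      then show ?thesis using w by simp
    qed
    show "\<bar>u\<bar> * norm (g u) \<le> enn2real (phi_star g)"
    proof (rule field_le_mult_one_interval)
      fix z :: real assume z: "0 < z" "z < 1"
      show "z * (\<bar>u\<bar> * norm (g u)) \<le> enn2real (phi_star g)"
      proof (cases "u = 0")
        case False
        then show ?thesis using le[of "z * \<bar>u\<bar>"] z by (auto simp: mult.assoc)
      qed simp
    qed
  qed
qed

section \<open>Convergence at a Lebesgue point\<close>

lemma finite_measure_circle: "finite_measure circle"
  unfolding circle_def by (rule finite_measure_lebesgue_on) simp

lemma Lp_circle_integrable: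
  assumes f: "f \<in> Lp_circle p" and p: "1 < p"
  shows "integrable circle f"
proof (rule integrableI_bounded)
  have m [measurable]: "f \<in> borel_measurable circle"
    and fin: "(\<integral>\<^sup>+t. ennreal (norm (f t) powr p) \<partial>circle) < \<infinity>"
    using f by (auto simp: Lp_circle_def)
  show "f \<in> borel_measurable circle" by (rule m)
  interpret finite_measure circle by (rule finite_measure_circle)
  have "(\<integral>\<^sup>+t. ennreal (norm (f t)) \<partial>circle) \<le> (\<integral>\<^sup>+t. 1 + ennreal (norm (f t) powr p) \<partial>circle)"
  proof (intro nn_integral_mono)
    fix t
    have "norm (f t) \<le> 1 + norm (f t) powr p"
    proof (cases "norm (f t) \<le> 1")
      case False
      then have "norm (f t) powr 1 \<le> norm (f t) powr p" using p by (intro powr_mono) auto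
      then show ?thesis by simp
    qed (simp add: add_increasing2)
    then show "ennreal (norm (f t)) \<le> 1 + ennreal (norm (f t) powr p)"
      using ennreal_leI by (metis ennreal_1 ennreal_plus powr_ge_zero zero_le_one)
  qed
  also have "\<dots> = emeasure circle (space circle) + (\<integral>\<^sup>+t. ennreal (norm (f t) powr p) \<partial>circle)"
    by (simp add: nn_integral_add)
  also have "\<dots> < \<infinity>" using fin by (simp add: less_top[symmetric])
  finally show "(\<integral>\<^sup>+t. ennreal (norm (f t)) \<partial>circle) < \<infinity>" .
qed

text \<open>After the substitution \<open>u = y - t\<close> the constant \<open>c\<close> is moved under the integral. The result refers
  to \<open>g\<close> centred at the origin, where its majorant is available.\<close>
lemma norm_convolution_diff_le:
  fixes f g :: "real \<Rightarrow> complex" and c :: complex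
  assumes g: "g \<in> Linf_circle" and fp: "periodic_fun_simple f (2 * pi)"
    and fm: "f \<in> borel_measurable lebesgue" and fi: "integrable circle f"
  shows "ennreal (norm ((LINT t|circle. g (y - t) * f t) - c * (LINT t|circle. g t)))
    \<le> (\<integral>\<^sup>+u\<in>{-pi..pi}. ennreal (norm (g u) * norm (f (y - u) - c)) \<partial>lebesgue)"
proof -
  have gp: "periodic_fun_simple g (2 * pi)"
    using g unfolding Linf_circle_def by simp
  interpret g: periodic_fun_simple g "2 * pi" by fact
  interpret f: periodic_fun_simple f "2 * pi" by fact
  interpret finite_measure circle by (rule finite_measure_circle)
  have gm: "g \<in> borel_measurable lebesgue" by (rule Linf_circle_lebesgue_measurable[OF g])
  define N where "N = enn2real (Linf_norm g)"
  have N: "AE u in circle. norm (g u) \<le> N"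
    unfolding N_def circle_def using AE_le_Linf_norm[OF g]
    by (subst AE_restrict_space_iff) (auto elim: eventually_mono)
  have gi: "integrable circle g"
    using N borel_measurable_circle[OF gm] by (intro integrable_const_bound[of _ N])
  have fy: "f (y - (u + 2 * pi)) = f (y - u)" for u
    using f.minus_1[of "y - u"] by (simp add: algebra_simps)
  note [measurable] = gm fm borel_measurable_lebesgue_reflect[OF fm] borel_measurable_lebesgue_reflect[OF gm]
  note cm = borel_measurable_circle
  have gfi: "integrable circle (\<lambda>t. g (y - t) * f t)"
  proof (rule integrableI_bounded)
    show "(\<lambda>t. g (y - t) * f t) \<in> borel_measurable circle" by (rule cm) measurable
    have "(\<integral>\<^sup>+t. ennreal (norm (g (y - t) * f t)) \<partial>circle)
        = (\<integral>\<^sup>+u. ennreal (norm (g u * f (y - u))) \<partial>circle)"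
      using nn_integral_circle_reflect[of "\<lambda>u. ennreal (norm (g u * f (y - u)))" y]
      by (simp add: periodic_fun_simple_def g.plus_period fy)
    also have "\<dots> \<le> (\<integral>\<^sup>+u. ennreal N * ennreal (norm (f (y - u))) \<partial>circle)"
    proof (rule nn_integral_mono_AE, use N in eventually_elim)
      case (elim u)
      then have "0 \<le> N" using norm_ge_zero order_trans by blast
      with elim show ?case
        by (auto simp: ennreal_mult[symmetric] norm_mult intro!: ennreal_leI mult_right_mono)
    qed
    also have "\<dots> = ennreal N * (\<integral>\<^sup>+u. ennreal (norm (f (y - u))) \<partial>circle)"
      by (rule nn_integral_cmult, rule cm) measurable
    also have "(\<integral>\<^sup>+u. ennreal (norm (f (y - u))) \<partial>circle) = (\<integral>\<^sup>+u. ennreal (norm (f u)) \<partial>circle)"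
      by (rule nn_integral_circle_reflect[of "\<lambda>u. ennreal (norm (f u))"])
        (simp_all add: periodic_fun_simple_def f.plus_period)
    also have "ennreal N * \<dots> < \<infinity>"
      using fi by (simp add: integrable_iff_bounded ennreal_mult_less_top)
    finally show "(\<integral>\<^sup>+t. ennreal (norm (g (y - t) * f t)) \<partial>circle) < \<infinity>" .
  qed
  have "(LINT t|circle. g (y - t) * f t) - c * (LINT t|circle. g t)
      = (LINT t|circle. g (y - t) * f t) - c * (LINT t|circle. g (y - t))"
    by (simp add: integral_circle_reflect[OF gp gm gi])
  also have "\<dots> = (LINT t|circle. g (y - t) * f t - c * g (y - t))"
    using gfi integrable_circle_reflect[OF gp gm gi]
    by (subst Bochner_Integration.integral_diff) auto
  also have "\<dots> = (LINT t|circle. g (y - t) * (f t - c))"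
    by (simp add: algebra_simps)
  also have "ennreal (norm \<dots>) \<le> (\<integral>\<^sup>+t. ennreal (norm (g (y - t) * (f t - c))) \<partial>circle)"
  proof (rule integral_norm_bound_ennreal)
    have "integrable circle (\<lambda>t. g (y - t) * f t - c * g (y - t))"
      using gfi integrable_circle_reflect[OF gp gm gi] by auto
    then show "integrable circle (\<lambda>t. g (y - t) * (f t - c))" by (simp add: algebra_simps)
  qed
  also have "\<dots> = (\<integral>\<^sup>+u. ennreal (norm (g u * (f (y - u) - c))) \<partial>circle)"
    using nn_integral_circle_reflect[of "\<lambda>u. ennreal (norm (g u * (f (y - u) - c)))" y]
    by (simp add: periodic_fun_simple_def g.plus_period fy)
  finally show ?thesis by (simp add: nn_integral_circle norm_mult)
qed

lemma set_nn_integral_reflect_le: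
  fixes G :: "real \<Rightarrow> ennreal"
  assumes [measurable]: "G \<in> borel_measurable lebesgue" and sub: "\<bar>s\<bar> + w \<le> h"
  shows "(\<integral>\<^sup>+u\<in>{-w..w}. G (s - u) \<partial>lebesgue) \<le> (\<integral>\<^sup>+v\<in>{-h..h}. G v \<partial>lebesgue)"
proof -
  have "(\<integral>\<^sup>+u\<in>{-w..w}. G (s - u) \<partial>lebesgue) \<le> (\<integral>\<^sup>+u. G (s - u) * indicator {-h..h} (s - u) \<partial>lebesgue)"
    using sub by (intro nn_integral_mono) (auto simp: indicator_def)
  also have "\<dots> = (\<integral>\<^sup>+v\<in>{-h..h}. G v \<partial>lebesgue)"
    by (rule nn_integral_lebesgue_reflect) measurable
  finally show ?thesis .
qed

text \<open>The estimate for a single kernel, with \<open>G v = \<bar>f (x + v) - f x\<bar>\<close> and \<open>y = x + s\<close> in mind. For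
  \<open>\<bar>u\<bar> \<le> 2 l\<close> the kernel is controlled by its two sup bounds and \<open>G\<close> by its \<open>L\<^sup>p\<close> mean. For
  \<open>2 l \<le> \<bar>u\<bar> \<le> D\<close> the displacement \<open>s\<close> is no longer felt, since \<open>\<bar>u\<bar> \<le> 2 w\<close> and
  \<open>\<bar>s\<bar> \<le> l \<le> w\<close> give \<open>\<bar>s - u\<bar> \<le> 3 w\<close>, and the \<open>L\<^sup>1\<close> mean of \<open>G\<close> suffices. For \<open>\<bar>u\<bar> > D\<close> the kernel
  itself is at most \<open>\<phi>\<^sup>*(D)\<close>.\<close>
lemma kernel_deviation_bound:
  fixes G :: "real \<Rightarrow> real" and l D s p \<eta> \<epsilon> \<epsilon>' :: real
  assumes g: "g \<in> Linf_circle" and Gm: "G \<in> borel_measurable lebesgue" and G0: "\<And>v. 0 \<le> G v"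
    and p: "1 < p" and \<eta>: "0 < \<eta>" and \<epsilon>: "0 \<le> \<epsilon>"
    and l: "0 < l" "2 * l \<le> D" "D \<le> pi" and s: "\<bar>s\<bar> \<le> l"
    and near: "(\<integral>\<^sup>+v\<in>{-3*l..3*l}. ennreal (G v powr p) \<partial>lebesgue) \<le> ennreal (\<epsilon>' * l)"
    and far: "\<And>h. h \<in> {0<..3*D} \<Longrightarrow> (\<integral>\<^sup>+v\<in>{-h..h}. ennreal (G v) \<partial>lebesgue) \<le> ennreal (\<epsilon> * h)"
  shows "(\<integral>\<^sup>+u\<in>{-pi..pi}. ennreal (norm (g u) * G (s - u)) \<partial>lebesgue)
    \<le> ennreal (2 * p * \<eta>)
      + ennreal (enn2real (Linf_norm g) * enn2real (phi_star g) powr (p - 1) * \<eta> powr (1 - p)) * ennreal (\<epsilon>' * l)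
      + ennreal (6 * \<epsilon>) * (\<integral>\<^sup>+w. majorant g w \<partial>circle)
      + majorant g D * (\<integral>\<^sup>+u. ennreal (G (s - u)) \<partial>circle)"
proof -
  define N where "N = enn2real (Linf_norm g)"
  define S where "S = enn2real (phi_star g)"
  define k where "k u = norm (g u)" for u
  define H where "H u = ennreal (G (s - u))" for u
  have gm [measurable]: "g \<in> borel_measurable lebesgue" by (rule Linf_circle_lebesgue_measurable[OF g])
  have km [measurable]: "k \<in> borel_measurable lebesgue" unfolding k_def by measurable
  have Gs [measurable]: "(\<lambda>u. G (s - u)) \<in> borel_measurable lebesgue"
    by (rule borel_measurable_lebesgue_reflect[OF Gm])
  have Hm [measurable]: "H \<in> borel_measurable lebesgue" unfolding H_def by measurable
  have Mm [measurable]: "majorant g \<in> borel_measurable lebesgue" by (rule borel_measurable_majorant[OF gm])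
  have maj: "AE u in lebesgue. \<bar>u\<bar> \<le> pi \<longrightarrow> (\<forall>w\<in>{0<..<\<bar>u\<bar>}. ennreal (k u) \<le> majorant g w)"
    unfolding k_def by (rule AE_le_majorant[OF gm])
  let ?I1 = "\<integral>\<^sup>+u\<in>{-2*l..2*l}. ennreal (k u * G (s - u)) \<partial>lebesgue"
  let ?I2 = "\<integral>\<^sup>+u\<in>{u. 2 * l \<le> \<bar>u\<bar> \<and> \<bar>u\<bar> \<le> D}. ennreal (k u) * H u \<partial>lebesgue"
  let ?I3 = "\<integral>\<^sup>+u\<in>{-pi..pi}. majorant g D * H u \<partial>lebesgue"
  have A: "{u. 2 * l \<le> \<bar>u\<bar> \<and> \<bar>u\<bar> \<le> D} \<in> sets lebesgue"
    using annulus_in_sets_lebesgue[of "2 * l" D] l by simp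
  have I1: "?I1 \<le> ennreal (2 * p * \<eta>) + ennreal (N * S powr (p - 1) * \<eta> powr (1 - p)) * ennreal (\<epsilon>' * l)"
  proof -
    have "AE u in lebesgue. u \<in> {-2*l..2*l} \<longrightarrow> k u \<le> N \<and> \<bar>u\<bar> * k u \<le> S"
      using AE_le_Linf_norm[OF g] AE_le_phi_star[OF g]
      by eventually_elim (use l in \<open>auto simp: k_def N_def S_def\<close>)
    then have "?I1 \<le> ennreal (2 * p * \<eta>) + ennreal (N * S powr (p - 1) * \<eta> powr (1 - p)) *
        (\<integral>\<^sup>+u\<in>{-2*l..2*l}. ennreal (G (s - u) powr p) \<partial>lebesgue)"
      using p \<eta> G0 by (intro kernel_near_bound) (auto simp: k_def N_def S_def)
    also have "(\<integral>\<^sup>+u\<in>{-2*l..2*l}. ennreal (G (s - u) powr p) \<partial>lebesgue)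
        \<le> (\<integral>\<^sup>+v\<in>{-3*l..3*l}. ennreal (G v powr p) \<partial>lebesgue)"
      using set_nn_integral_reflect_le[of "\<lambda>v. ennreal (G v powr p)" s "2 * l" "3 * l"] Gm s by simp
    also note near
    finally show ?thesis by (simp add: add_left_mono mult_left_mono)
  qed
  have I2: "?I2 \<le> ennreal (6 * \<epsilon>) * (\<integral>\<^sup>+w. majorant g w \<partial>circle)"
  proof -
    have "?I2 \<le> ennreal (2 * (3 * \<epsilon>)) * (\<integral>\<^sup>+w\<in>{0..D}. majorant g w \<partial>lebesgue)"
    proof (rule kernel_far_bound)
      show "AE u in lebesgue. \<bar>u\<bar> \<le> D \<longrightarrow> (\<forall>w\<in>{0<..<\<bar>u\<bar>}. ennreal (k u) \<le> majorant g w)"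
        using maj by eventually_elim (use l in auto)
      fix w assume w: "w \<in> {l..D}"
      have "(\<integral>\<^sup>+u\<in>{-2*w..2*w}. H u \<partial>lebesgue) \<le> (\<integral>\<^sup>+v\<in>{-3*w..3*w}. ennreal (G v) \<partial>lebesgue)"
        unfolding H_def
        using set_nn_integral_reflect_le[of "\<lambda>v. ennreal (G v)" s "2 * w" "3 * w"] Gm s w by simp
      also have "\<dots> \<le> ennreal (\<epsilon> * (3 * w))"
        using far[of "3 * w"] w l by simp
      finally show "(\<integral>\<^sup>+u\<in>{-2*w..2*w}. H u \<partial>lebesgue) \<le> ennreal (3 * \<epsilon> * w)"
        by (simp add: mult_ac)
    qed (use l \<epsilon> in auto)
    also have "(\<integral>\<^sup>+w\<in>{0..D}. majorant g w \<partial>lebesgue) \<le> (\<integral>\<^sup>+w. majorant g w \<partial>circle)"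
      unfolding nn_integral_circle using l by (intro nn_integral_mono) (auto simp: indicator_def)
    finally show ?thesis by (simp add: mult_left_mono)
  qed
  have I3: "?I3 = majorant g D * (\<integral>\<^sup>+u. ennreal (G (s - u)) \<partial>circle)"
    unfolding nn_integral_circle H_def[symmetric] mult.assoc by (rule nn_integral_cmult) measurable
  have "(\<integral>\<^sup>+u\<in>{-pi..pi}. ennreal (k u * G (s - u)) \<partial>lebesgue)
      \<le> (\<integral>\<^sup>+u. (ennreal (k u * G (s - u)) * indicator {-2*l..2*l} u
          + ennreal (k u) * H u * indicator {u. 2 * l \<le> \<bar>u\<bar> \<and> \<bar>u\<bar> \<le> D} u)
          + majorant g D * H u * indicator {-pi..pi} u \<partial>lebesgue)"
    (is "_ \<le> (\<integral>\<^sup>+u. ?R u \<partial>lebesgue)")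
  proof (rule nn_integral_mono_AE, use maj in eventually_elim)
    case (elim u)
    have kG: "ennreal (k u * G (s - u)) = ennreal (k u) * H u"
      using G0 by (simp add: H_def k_def ennreal_mult)
    consider "\<bar>u\<bar> \<le> 2 * l" | "2 * l \<le> \<bar>u\<bar>" "\<bar>u\<bar> \<le> D" | "D < \<bar>u\<bar>" "\<bar>u\<bar> \<le> pi" | "\<bar>u\<bar> > pi"
      by linarith
    then show "ennreal (k u * G (s - u)) * indicator {-pi..pi} u \<le> ?R u"
    proof cases
      case 1
      then have "indicator {-2*l..2*l} u = (1::ennreal)" by (auto simp: indicator_def)
      then show ?thesis by (auto simp: indicator_def add_increasing2)
    next
      case 2
      then have "indicator {u. 2 * l \<le> \<bar>u\<bar> \<and> \<bar>u\<bar> \<le> D} u = (1::ennreal)" by (auto simp: indicator_def)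
      then show ?thesis unfolding kG by (auto simp: indicator_def add_increasing add_increasing2)
    next
      case 3
      then have "ennreal (k u) \<le> majorant g D" using elim l by auto
      then have "ennreal (k u) * H u \<le> majorant g D * H u" by (intro mult_right_mono) auto
      moreover have "indicator {-pi..pi} u = (1::ennreal)" using 3 by (auto simp: indicator_def)
      ultimately show ?thesis unfolding kG by (simp add: add_increasing)
    next
      case 4
      then have "indicator {-pi..pi} u = (0::ennreal)" by (auto simp: indicator_def)
      then show ?thesis by simp
    qed
  qed
  also have "\<dots> = ?I1 + ?I2 + ?I3"
    using A by (simp add: nn_integral_add)
  also have "\<dots> \<le> (ennreal (2 * p * \<eta>) + ennreal (N * S powr (p - 1) * \<eta> powr (1 - p)) * ennreal (\<epsilon>' * l))
      + ennreal (6 * \<epsilon>) * (\<integral>\<^sup>+w. majorant g w \<partial>circle)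
      + majorant g D * (\<integral>\<^sup>+u. ennreal (G (s - u)) \<partial>circle)"
    unfolding I3 by (intro add_mono I1 I2 order_refl)
  finally show ?thesis by (simp add: k_def N_def S_def)
qed

text \<open>Given \<open>e\<close>, the threshold \<open>\<eta>\<close> is fixed first; the bound \<open>P\<close> on \<open>\<lambda>(r) \<parallel>\<phi>\<^sub>r\<parallel> \<phi>\<^sub>*(r)\<^bsup>p - 1\<^esup>\<close> then tells how small the \<open>L\<^sup>p\<close> mean \<open>\<epsilon>'\<close> must be, and the bound
  \<open>C\<close> on the integrals of the majorants how small the \<open>L\<^sup>1\<close> mean \<open>\<epsilon>\<close>. This determines a radius \<open>D\<close>, after
  which everything else holds for \<open>r\<close> close to \<open>1\<close>.\<close>
lemma lambda_limit_at_Lp_lebesgue_point: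
  fixes \<phi> :: "real \<Rightarrow> real \<Rightarrow> complex" and lam :: "real \<Rightarrow> real" and p :: real
  assumes \<phi>: "approximate_identity \<phi>"
    and p: "1 < p"
    and lam_pos: "\<And>r. 0 < r \<Longrightarrow> r < 1 \<Longrightarrow> 0 < lam r"
    and lam: "(lam \<longlongrightarrow> 0) (at_left 1)"
    and Pi: "Pi_p p lam \<phi> < \<infinity>"
    and f: "f \<in> Lp_circle p"
    and x: "Lp_lebesgue_point p f x"
  shows "lambda_limit lam x (\<lambda>r y. Phi \<phi> r y f) (f x)"
proof -
  have fp: "periodic_fun_simple f (2 * pi)" and "f \<in> borel_measurable circle"
    using f by (auto simp: Lp_circle_def)
  then have fm: "f \<in> borel_measurable lebesgue" by (rule periodic_borel_measurable_lebesgue)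
  have fi: "integrable circle f" by (rule Lp_circle_integrable[OF f p])
  interpret f: periodic_fun_simple f "2 * pi" by fact
  interpret finite_measure circle by (rule finite_measure_circle)
  define N where "N r = enn2real (Linf_norm (\<phi> r))" for r
  define S where "S r = enn2real (phi_star (\<phi> r))" for r
  define I where "I r = (LINT t|circle. \<phi> r t)" for r
  define G where "G v = norm (f (x + v) - f x)" for v
  have Gm: "G \<in> borel_measurable lebesgue"
    unfolding G_def using borel_measurable_lebesgue_translate[OF fm, of x] by measurable
  have Linf: "\<phi> r \<in> Linf_circle" if "r \<in> {0<..<1}" for r
    using \<phi> that by (auto simp: approximate_identity_def)
  define C where "C = enn2real (SUP r\<in>{0<..<1}. \<integral>\<^sup>+x. majorant (\<phi> r) x \<partial>circle)"
  have C: "(\<integral>\<^sup>+x. majorant (\<phi> r) x \<partial>circle) \<le> ennreal C" if "r \<in> {0<..<1}" for r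
  proof -
    have "(SUP r\<in>{0<..<1}. \<integral>\<^sup>+x. majorant (\<phi> r) x \<partial>circle) < \<infinity>"
      using \<phi> by (auto simp: approximate_identity_def)
    then show ?thesis
      unfolding C_def using that by (subst ennreal_enn2real) (auto intro: SUP_upper)
  qed
  have C0: "C \<ge> 0" by (simp add: C_def)
  obtain P where P: "P > 0" "eventually (\<lambda>r. lam r * N r * S r powr (p - 1) \<le> P) (at_left 1)"
  proof -
    obtain z where z: "Pi_p p lam \<phi> < z" "z < \<infinity>" using Pi dense by blast
    define P where "P = enn2real z"
    have zP: "z = ennreal P" using z by (simp add: P_def)
    have "0 < z" using z(1) by (simp add: order_le_less_trans[OF zero_le])
    then have P: "P > 0" by (simp add: zP)
    have "eventually (\<lambda>r. ennreal (lam r * N r * S r powr (p - 1)) < z) (at_left 1)"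
      using Limsup_lessD[OF z(1)[unfolded Pi_p_def]] by (simp add: N_def S_def)
    then have "eventually (\<lambda>r. lam r * N r * S r powr (p - 1) \<le> P) (at_left 1)"
      by eventually_elim (use P in \<open>auto simp: zP dest!: less_imp_le simp: ennreal_le_iff\<close>)
    with P show ?thesis by (rule that)
  qed
  define L where "L = enn2real (\<integral>\<^sup>+t. ennreal (norm (f t - f x)) \<partial>circle)"
  have L: "(\<integral>\<^sup>+u. ennreal (G (s - u)) \<partial>circle) = ennreal L" for s
  proof -
    have "integrable circle (\<lambda>t. f t - f x)" using fi by auto
    then have "(\<integral>\<^sup>+t. ennreal (norm (f t - f x)) \<partial>circle) < \<infinity>"
      by (simp add: integrable_iff_bounded)
    then have "ennreal L = (\<integral>\<^sup>+t. ennreal (norm (f t - f x)) \<partial>circle)"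
      unfolding L_def by (intro ennreal_enn2real) auto
    also have "\<dots> = (\<integral>\<^sup>+u. ennreal (norm (f (x + s - u) - f x)) \<partial>circle)"
      using fm by (intro nn_integral_circle_reflect[symmetric, of "\<lambda>t. ennreal (norm (f t - f x))"])
        (auto simp: periodic_fun_simple_def f.plus_period)
    finally show ?thesis by (simp add: G_def add_diff_eq)
  qed
  have L0: "L \<ge> 0" by (simp add: L_def)
  have main: "eventually (\<lambda>r. (SUP y\<in>arc_around lam r x. ennreal (norm (Phi \<phi> r y f - f x))) \<le> ennreal e) (at_left 1)"
    if e: "0 < e" for e
  proof -
    \<comment> \<open>Each of the four terms of the kernel estimate, and the error from \<open>\<integral>\<phi>\<^sub>r \<noteq> 1\<close>, gets a fifth
      of \<open>e\<close>. The summand \<open>1\<close> in \<open>C + 1\<close> and \<open>L + 1\<close> only avoids division by zero.\<close>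
    define \<eta> where "\<eta> = e / (10 * p)"
    define \<epsilon>' where "\<epsilon>' = e / (5 * P * \<eta> powr (1 - p))"
    define \<epsilon> where "\<epsilon> = e / (30 * (C + 1))"
    have \<eta>: "\<eta> > 0" and \<epsilon>: "\<epsilon> > 0" using e p C0 by (auto simp: \<eta>_def \<epsilon>_def)
    have \<epsilon>': "\<epsilon>' > 0" using e P \<eta> by (auto simp: \<epsilon>'_def)
    have "\<epsilon>' / 3 > 0" using \<epsilon>' by simp
    then obtain \<delta>1 where \<delta>1: "\<delta>1 > 0" "\<And>h. h \<in> {0<..\<delta>1} \<Longrightarrow>
        (\<integral>\<^sup>+v\<in>{-h..h}. ennreal (norm (f (x + v) - f x) powr p) \<partial>lebesgue) \<le> ennreal (\<epsilon>' / 3 * h)"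
      using x unfolding Lp_lebesgue_point_def by blast
    obtain \<delta>2 where \<delta>2: "\<delta>2 > 0" "\<And>h. h \<in> {0<..\<delta>2} \<Longrightarrow>
        (\<integral>\<^sup>+v\<in>{-h..h}. ennreal (norm (f (x + v) - f x) powr 1) \<partial>lebesgue) \<le> ennreal (\<epsilon> * h)"
      using Lp_lebesgue_point_imp_L1[OF x p fm] \<epsilon> unfolding Lp_lebesgue_point_def by blast
    define D where "D = min (\<delta>2 / 3) pi"
    have D: "0 < D" "D \<le> pi" "3 * D \<le> \<delta>2" using \<delta>2(1) by (auto simp: D_def)
    have ev1: "eventually (\<lambda>r. r \<in> {0<..<1}) (at_left (1::real))"
      by (rule eventually_at_leftI[of 0]) auto
    have ev2: "eventually (\<lambda>r. lam r < min (\<delta>1 / 3) (D / 2)) (at_left 1)"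
      using \<delta>1(1) D by (intro order_tendstoD(2)[OF lam]) auto
    have "((\<lambda>r. majorant (\<phi> r) D) \<longlongrightarrow> 0) (at_left 1)"
      using \<phi> D by (auto simp: approximate_identity_def)
    then have ev3: "eventually (\<lambda>r. majorant (\<phi> r) D < ennreal (e / (5 * (L + 1)))) (at_left 1)"
      using e L0 by (intro order_tendstoD(2)) auto
    have "(I \<longlongrightarrow> 1) (at_left 1)"
      using \<phi> by (auto simp: approximate_identity_def I_def[abs_def])
    then have "((\<lambda>r. norm (f x) * norm (I r - 1)) \<longlongrightarrow> norm (f x) * norm (1 - 1 :: complex)) (at_left 1)"
      by (intro tendsto_intros)
    then have ev4: "eventually (\<lambda>r. norm (f x) * norm (I r - 1) < e / 5) (at_left 1)"
      using e by (intro order_tendstoD(2)) auto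
    show ?thesis
      using ev1 ev2 ev3 ev4 P(2)
    proof eventually_elim
      case (elim r)
      define l where "l = lam r"
      have l: "0 < l" "3 * l \<le> \<delta>1" "2 * l \<le> D"
        using elim(1,2) lam_pos[of r] by (auto simp: l_def)
      show ?case
      proof (rule SUP_least)
        fix y assume "y \<in> arc_around lam r x"
        then have s: "\<bar>y - x\<bar> \<le> l"
          using l D by (auto simp: arc_around_def l_def split: if_splits)
        have "ennreal (norm (Phi \<phi> r y f - f x * I r))
            \<le> (\<integral>\<^sup>+u\<in>{-pi..pi}. ennreal (norm (\<phi> r u) * norm (f (y - u) - f x)) \<partial>lebesgue)"
          unfolding Phi_def I_def by (rule norm_convolution_diff_le[OF Linf[OF elim(1)] fp fm fi])
        also have "\<dots> = (\<integral>\<^sup>+u\<in>{-pi..pi}. ennreal (norm (\<phi> r u) * G (y - x - u)) \<partial>lebesgue)"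
          by (simp add: G_def add_diff_eq)
        also have "\<dots> \<le> ennreal (2 * p * \<eta>)
            + ennreal (N r * S r powr (p - 1) * \<eta> powr (1 - p)) * ennreal (\<epsilon>' * l)
            + ennreal (6 * \<epsilon>) * (\<integral>\<^sup>+w. majorant (\<phi> r) w \<partial>circle)
            + majorant (\<phi> r) D * (\<integral>\<^sup>+u. ennreal (G (y - x - u)) \<partial>circle)"
          unfolding N_def S_def
        proof (rule kernel_deviation_bound[OF Linf[OF elim(1)] Gm _ p \<eta> less_imp_le[OF \<epsilon>] l(1) l(3) D(2) s])
          show "(\<integral>\<^sup>+v\<in>{-3*l..3*l}. ennreal (G v powr p) \<partial>lebesgue) \<le> ennreal (\<epsilon>' * l)"
            using \<delta>1(2)[of "3 * l"] l by (simp add: G_def)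
          show "(\<integral>\<^sup>+v\<in>{-h..h}. ennreal (G v) \<partial>lebesgue) \<le> ennreal (\<epsilon> * h)" if "h \<in> {0<..3*D}" for h
            using \<delta>2(2)[of h] that D by (simp add: G_def)
        qed (simp add: G_def)
        also have "\<dots> \<le> ennreal (e / 5) + ennreal (e / 5) + ennreal (e / 5) + ennreal (e / 5)"
        proof (intro add_mono)
          show "ennreal (2 * p * \<eta>) \<le> ennreal (e / 5)"
            using p by (simp add: \<eta>_def)
          have "N r * S r powr (p - 1) * \<eta> powr (1 - p) * (\<epsilon>' * l)
              = (lam r * N r * S r powr (p - 1)) * (\<eta> powr (1 - p) * \<epsilon>')"
            by (simp add: l_def mult_ac)
          also have "\<dots> \<le> P * (\<eta> powr (1 - p) * \<epsilon>')"
            using elim(5) \<epsilon>' by (intro mult_right_mono) auto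
          also have "\<dots> = e / 5" using P \<eta> by (simp add: \<epsilon>'_def)
          finally show "ennreal (N r * S r powr (p - 1) * \<eta> powr (1 - p)) * ennreal (\<epsilon>' * l) \<le> ennreal (e / 5)"
            using \<epsilon>' l by (simp add: ennreal_mult'[symmetric] ennreal_leI N_def)
          have "ennreal (6 * \<epsilon>) * (\<integral>\<^sup>+w. majorant (\<phi> r) w \<partial>circle) \<le> ennreal (6 * \<epsilon>) * ennreal C"
            by (intro mult_left_mono C elim(1)) auto
          also have "\<dots> = ennreal (6 * \<epsilon> * C)" using \<epsilon> C0 by (simp add: ennreal_mult)
          also have "\<dots> \<le> ennreal (e / 5)"
            using e C0 by (intro ennreal_leI) (simp add: \<epsilon>_def field_simps)
          finally show "ennreal (6 * \<epsilon>) * (\<integral>\<^sup>+w. majorant (\<phi> r) w \<partial>circle) \<le> ennreal (e / 5)" .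
          have "majorant (\<phi> r) D * ennreal L \<le> ennreal (e / (5 * (L + 1))) * ennreal L"
            using elim(3) by (intro mult_right_mono) auto
          also have "\<dots> = ennreal (e / (5 * (L + 1)) * L)"
            by (rule ennreal_mult[symmetric]) (use e L0 in auto)
          also have "\<dots> \<le> ennreal (e / 5)"
            using e L0 by (intro ennreal_leI) (simp add: field_simps)
          finally show "majorant (\<phi> r) D * (\<integral>\<^sup>+u. ennreal (G (y - x - u)) \<partial>circle) \<le> ennreal (e / 5)"
            unfolding L .
        qed
        also have "\<dots> = ennreal (4 * e / 5)"
          using e by (simp add: ennreal_plus[symmetric] del: ennreal_plus)
        finally have "norm (Phi \<phi> r y f - f x * I r) \<le> 4 * e / 5" using e by simp
        moreover have "norm (Phi \<phi> r y f - f x) \<le> norm (Phi \<phi> r y f - f x * I r) + norm (f x) * norm (I r - 1)"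
        proof -
          have "Phi \<phi> r y f - f x = (Phi \<phi> r y f - f x * I r) + f x * (I r - 1)"
            by (simp add: algebra_simps)
          then show ?thesis by (metis norm_triangle_ineq norm_mult)
        qed
        ultimately show "ennreal (norm (Phi \<phi> r y f - f x)) \<le> ennreal e"
          using elim(4) by (intro ennreal_leI) linarith
      qed
    qed
  qed
  show ?thesis
    unfolding lambda_limit_def
  proof (rule order_tendstoI)
    fix a :: ennreal assume "0 < a"
    then obtain z where z: "0 < z" "z < a" using dense by blast
    then have "z < \<infinity>" using less_le_trans top_greatest by fastforce
    then have ze: "z = ennreal (enn2real z)" by simp
    then have "0 < enn2real z" using z(1) by (metis ennreal_less_zero_iff)
    from main[OF this] show "eventually (\<lambda>r. (SUP y\<in>arc_around lam r x. ennreal (norm (Phi \<phi> r y f - f x))) < a) (at_left 1)"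
      unfolding ze[symmetric] by (rule eventually_mono) (rule order_le_less_trans[OF _ z(2)])
  qed simp
qed

theorem theorem2p1:
  fixes \<phi> :: "real \<Rightarrow> real \<Rightarrow> complex" and lam :: "real \<Rightarrow> real" and p :: real
  assumes "approximate_identity \<phi>"
    and "1 < p"
    and "\<And>r. 0 < r \<Longrightarrow> r < 1 \<Longrightarrow> 0 < lam r"
    and "(lam \<longlongrightarrow> 0) (at_left 1)"
    and "Pi_p p lam \<phi> < \<infinity>"
  shows "\<forall>f\<in>Lp_circle p. AE x in circle. lambda_limit lam x (\<lambda>r y. Phi \<phi> r y f) (f x)"
proof
  fix f assume f: "f \<in> Lp_circle p"
  have "AE x in circle. Lp_lebesgue_point p f x"
    using f assms(2) by (intro AE_Lp_lebesgue_point) auto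
  then show "AE x in circle. lambda_limit lam x (\<lambda>r y. Phi \<phi> r y f) (f x)"
    by eventually_elim (rule lambda_limit_at_Lp_lebesgue_point[OF assms f])
qed

end
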